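(* Let $C$ be a smooth projective curve of genus $2$ defined over $\mathbb{Q}$ with good reduction at the prime $2$, and assume that $C$ has exactly three $\mathbb{Q}$-rational Weierstrass points. If $C$ is described by a globally minimal Weierstrass equation of the form $E:\ y^2+Q(x)y=P(x)$ with $P,Q\in\mathbb{Z}[x]$, $\deg Q(x)\le 2$ and $P(x)$ monic of degree $5$, such that $|\Delta_E|$ is a square-free odd integer, then, for some $t\in\mathbb{Z}$, $C$ is isomorphic over $\mathbb{Q}$ to the curve given by one of the following globally minimal Weierstrass equations: $$E_t:\ y^2-x^2y=x^5+16t\,x^4+(16+8t)\,x^3+(8+t)\,x^2+x;$$ $$F_t:\ y^2+(-x^2-x)\,y=x^5+(-1+t)\,x^4+(-2-2t)\,x^3+(2+t)\,x^2-x.$$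
   Context: A Weierstrass equation of a genus two curve $C$ over $\mathbb{Q}$ is an equation $y^2+Q(x)y=P(x)$ with $P,Q\in\mathbb{Q}[x]$, $\deg Q\le 3$, $\deg P\le 6$, such that $x$ generates the subfield of $\mathbb{Q}(C)$ fixed by the hyperelliptic involution and $\mathbb{Q}(C)=\mathbb{Q}(x)[y]$. Its discriminant is $\Delta_E=2^{-12}\operatorname{disc}(4P(x)+Q(x)^2)$. A Weierstrass equation is integral if $P,Q\in\mathbb{Z}[x]$; it is minimal at a prime $p$ if it is integral and the $p$-adic valuation of its discriminant is smallest among all integral Weierstrass equations describing $C$ over $\mathbb{Z}_p$; it is globally minimal if it is minimal at every prime. Weierstrass points of $C$ are the fixed points of the hyperelliptic involution; $\mathbb{Q}$-rational ones are those defined over $\mathbb{Q}$. *)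

theory Defs
  imports "HOL-Computational_Algebra.Computational_Algebra" "Subresultants.Resultant_Prelim"
begin

text \<open>A genus-2 Weierstrass equation y^2 + Q(x) y = P(x) over the rationals is
  represented by the pair (P, Q) of rational polynomials.\<close>

type_synonym weq = "rat poly \<times> rat poly"

definition poly_disc :: "rat poly \<Rightarrow> rat" where
  "poly_disc f = (let d = degree f in
     (-1) ^ (d * (d - 1) div 2) * resultant f (pderiv f) / lead_coeff f)"

text \<open>Discriminant of f regarded as a binary form of degree n
  (a binary form with leading coefficients a_n = 0 has a root at infinity;
   disc_n(f) = a_{n-1}^2 disc_{n-1}(f) if a_n = 0, and 0 if two roots at infinity).\<close>
definition form_disc :: "nat \<Rightarrow> rat poly \<Rightarrow> rat" where
  "form_disc n f = (if f \<noteq> 0 \<and> degree f + 1 \<ge> n \<and> degree f \<le> n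
      then lead_coeff f ^ (2 * (n - degree f)) * poly_disc f else 0)"

definition weq_F :: "weq \<Rightarrow> rat poly" where
  "weq_F E = Polynomial.smult 4 (fst E) + (snd E)^2"

definition weq_disc :: "weq \<Rightarrow> rat" where
  "weq_disc E = form_disc 6 (weq_F E) / 2 ^ 12"

definition is_genus2_weq :: "weq \<Rightarrow> bool" where
  "is_genus2_weq E \<longleftrightarrow> degree (fst E) \<le> 6 \<and> degree (snd E) \<le> 3 \<and> weq_disc E \<noteq> 0"

text \<open>Homogenised substitution: (c x + d)^n p((a x + b)/(c x + d)).\<close>
definition hsubst :: "nat \<Rightarrow> rat poly \<Rightarrow> rat \<Rightarrow> rat \<Rightarrow> rat \<Rightarrow> rat \<Rightarrow> rat poly" where
  "hsubst n p a b c d = (\<Sum>i\<le>n. Polynomial.smult (coeff p i) ([:b, a:] ^ i * [:d, c:] ^ (n - i)))"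

text \<open>The change of variables x = (a x' + b)/(c x' + d), y = (e y' + H(x'))/(c x' + d)^3
  transforms y^2 + Q y = P into y'^2 + Q' y' = P' with the formulas below.\<close>
definition weq_transform :: "weq \<Rightarrow> rat \<Rightarrow> rat \<Rightarrow> rat \<Rightarrow> rat \<Rightarrow> rat \<Rightarrow> rat poly \<Rightarrow> weq" where
  "weq_transform E a b c d e H =
     (let Qt = hsubst 3 (snd E) a b c d; Pt = hsubst 6 (fst E) a b c d in
      (Polynomial.smult (1 / e^2) (Pt - H * (H + Qt)), Polynomial.smult (1 / e) (Polynomial.smult 2 H + Qt)))"

definition weq_iso :: "weq \<Rightarrow> weq \<Rightarrow> bool" where
  "weq_iso E E' \<longleftrightarrow> (\<exists>a b c d e H. a * d - b * c \<noteq> 0 \<and> e \<noteq> 0 \<and> degree H \<le> 3 \<and>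
       E' = weq_transform E a b c d e H)"

definition rat_val :: "nat \<Rightarrow> rat \<Rightarrow> int" where
  "rat_val p r = (case quotient_of r of (n, m) \<Rightarrow>
      int (multiplicity (int p) n) - int (multiplicity (int p) m))"

definition int_rat :: "rat \<Rightarrow> bool" where
  "int_rat r \<longleftrightarrow> r \<in> \<int>"

definition loc_int :: "nat \<Rightarrow> rat \<Rightarrow> bool" where
  "loc_int p r \<longleftrightarrow> \<not> int p dvd snd (quotient_of r)"

definition integral_weq :: "weq \<Rightarrow> bool" where
  "integral_weq E \<longleftrightarrow> (\<forall>i. coeff (fst E) i \<in> \<int> \<and> coeff (snd E) i \<in> \<int>)"

definition loc_integral_weq :: "nat \<Rightarrow> weq \<Rightarrow> bool" where
  "loc_integral_weq p E \<longleftrightarrow> (\<forall>i. loc_int p (coeff (fst E) i) \<and> loc_int p (coeff (snd E) i))"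

definition minimal_at :: "nat \<Rightarrow> weq \<Rightarrow> bool" where
  "minimal_at p E \<longleftrightarrow> integral_weq E \<and>
     (\<forall>E'. weq_iso E E' \<and> loc_integral_weq p E' \<longrightarrow> rat_val p (weq_disc E) \<le> rat_val p (weq_disc E'))"

definition globally_minimal :: "weq \<Rightarrow> bool" where
  "globally_minimal E \<longleftrightarrow> (\<forall>p. prime p \<longrightarrow> minimal_at p E)"

definition good_reduction_at :: "nat \<Rightarrow> weq \<Rightarrow> bool" where
  "good_reduction_at p E \<longleftrightarrow>
     (\<exists>E'. weq_iso E E' \<and> loc_integral_weq p E' \<and> rat_val p (weq_disc E') = 0)"

text \<open>Number of Q-rational Weierstrass points: the affine ones are the points with
  2y + Q(x) = 0, i.e. x a rational root of 4P + Q^2; there is one rational Weierstrass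
  point at infinity iff 4P + Q^2 has degree at most 5.\<close>
definition num_rat_weierstrass_pts :: "weq \<Rightarrow> nat" where
  "num_rat_weierstrass_pts E =
     card {x :: rat. poly (weq_F E) x = 0} + (if degree (weq_F E) \<le> 5 then 1 else 0)"

definition E_fam :: "int \<Rightarrow> weq" where
  "E_fam t = ([:0, 1, of_int (8 + t), of_int (16 + 8 * t), of_int (16 * t), 1:], [:0, 0, -1:])"

definition F_fam :: "int \<Rightarrow> weq" where
  "F_fam t = ([:0, -1, of_int (2 + t), of_int (-2 - 2 * t), of_int (-1 + t), 1:], [:0, -1, -1:])"

end

theory Submission
  imports Defs
begin

text \<open>
  Completing the square, the isomorphism class of \<open>y\<^sup>2 + Q y = P\<close> is that of the binary sextic
  \<open>F = 4 P + Q\<^sup>2\<close> up to \<open>GL\<^sub>2\<close> and squares; here \<open>F\<close> has degree 5 and leading coefficient 4, so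
  infinity is one Weierstrass point and \<open>F\<close> has exactly two rational roots. Each of them is an
  integer or a quarter of an odd integer, and at most one is of the second kind. Move an integral
  root to 0 and let \<open>h\<close> be the cubic cofactor. Then \<open>2\<^sup>8 \<Delta>\<close> is the product of \<open>disc h\<close> and the square
  of (difference of the roots) \<open>\<times>\<close> (values of \<open>h\<close> at them). As \<open>\<Delta>\<close> is odd and squarefree, the
  integer being squared divides 16, and congruences modulo 4 coming from \<open>F = 4 P + Q\<^sup>2\<close> leave a
  few one-parameter families. One of them consists of simplest cubics, whose discriminant is
  a perfect square greater than 1, which is impossible; the others are carried to \<open>E\<^sub>t\<close> or \<open>F\<^sub>t\<close> by
  explicit Moebius maps of determinant \<open>\<plusminus>1\<close> permuting the three rational Weierstrass points. These
  preserve \<open>\<Delta>\<close>, so global minimality is inherited.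
\<close>

section \<open>Resultants and a linear factor\<close>

text \<open>With \<open>S\<close> the Sylvester matrix of \<open>(x - a) f\<close> and \<open>g\<close>, subtracting \<open>a\<close> times the next row in the
  \<open>g\<close>-block (matrix \<open>L\<close>) makes every row but the last divisible by \<open>x - a\<close>. The matrix \<open>T\<close> recombines
  quotient and remainder of the division by \<open>x - a\<close>, so that \<open>L S = S' T\<close> with the remainders in
  the last column of \<open>S'\<close>.\<close>

lemma resultant_mult_linear:
  fixes f g :: "'a :: idom poly"
  assumes "f \<noteq> 0"
  shows "resultant ([:- a, 1:] * f) g = poly g a * resultant f g"
proof -
  define k where "k = degree f"
  define n where "n = degree g"
  define N where "N = k + n"
  define h where "h = [:- a, 1:] * f"
  have degh: "degree h = Suc k"
    unfolding h_def k_def using assms by (subst degree_mult_eq) auto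
  define S where "S = sylvester_mat h g"
  have S: "S \<in> carrier_mat (Suc N) (Suc N)"
    unfolding S_def N_def n_def by (rule carrier_matI) (simp_all add: degh)
  \<comment> \<open>Row \<open>i\<close> of \<open>S\<close> read as a polynomial: column
    \<open>j\<close> holds the coefficient of \<open>x^(N - j)\<close>.\<close>
  define R where "R i = (if i < n then monom 1 (n - Suc i) * h else monom 1 (N - i) * g)" for i
  have S_index: "S $$ (i, j) = coeff (R i) (N - j)" if "i < Suc N" "j < Suc N" for i j
    using that degh unfolding S_def R_def N_def n_def
    by (subst sylvester_index_mat) (auto simp: coeff_monom_mult coeff_eq_0)
  define q where "q = synthetic_div g a"
  have g_eq: "[:- a, 1:] * q + [:poly g a:] = g"
    unfolding q_def by (metis synthetic_div_correct' add.commute)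
  \<comment> \<open>If row \<open>i\<close> of \<open>L * S\<close> is \<open>(x - a) u + v\<close>
    with \<open>v\<close> constant, then \<open>R' i\<close> is \<open>x u + v\<close>; multiplying
    by \<open>T\<close> turns the factor \<open>x\<close> into \<open>x - a\<close>.\<close>
  define R' where "R' i = (if i < n then pCons 0 (monom 1 (n - Suc i) * f)
      else if i < N then pCons 0 (monom 1 (N - Suc i) * g) else pCons (poly g a) q)" for i
  define S' where "S' = mat (Suc N) (Suc N) (\<lambda>(i, j). coeff (R' i) (N - j))"
  have S': "S' \<in> carrier_mat (Suc N) (Suc N)" unfolding S'_def by simp
  define T where "T = mat (Suc N) (Suc N) (\<lambda>(i, j). if j = i then 1 else if j = Suc i then - a else 0)"
  define L where "L = mat (Suc N) (Suc N)
    (\<lambda>(i, j). if j = i then 1 else if j = Suc i \<and> n \<le> i then - a else 0)"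
  have T: "T \<in> carrier_mat (Suc N) (Suc N)" and L: "L \<in> carrier_mat (Suc N) (Suc N)"
    unfolding T_def L_def by simp_all
  have detT: "det T = 1"
    by (subst det_upper_triangular[OF _ T])
      (auto simp: T_def upper_triangular_def diag_mat_def intro!: prod_list_neutral)
  have detL: "det L = 1"
    by (subst det_upper_triangular[OF _ L])
      (auto simp: L_def upper_triangular_def diag_mat_def intro!: prod_list_neutral)
  have degR': "degree (R' i) \<le> N" if "i < Suc N" for i
  proof -
    have "degree (monom 1 (n - Suc i) * f) < N" if "i < n"
      using that degree_mult_le[of "monom 1 (n - Suc i)" f]
      by (auto simp: degree_monom_eq N_def k_def)
    moreover have "degree (monom 1 (N - Suc i) * g) < N" if "\<not> i < n" "i < N"
      using that degree_mult_le[of "monom 1 (N - Suc i)" g]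
      by (auto simp: degree_monom_eq N_def n_def)
    moreover have "degree (pCons (poly g a) q) \<le> N"
      by (auto simp: q_def degree_synthetic_div degree_pCons_eq_if N_def n_def synthetic_div_eq_0_iff)
    ultimately show ?thesis unfolding R'_def by (auto simp: degree_pCons_eq_if)
  qed
  have "S' * T = L * S"
  proof (rule eq_matI)
    fix i j assume "i < dim_row (L * S)" "j < dim_col (L * S)"
    hence i: "i < Suc N" and j: "j < Suc N" using L S by auto
    have "(S' * T) $$ (i, j) = (\<Sum>l<Suc N. coeff (R' i) (N - l) * (T $$ (l, j)))"
      using i j S' T by (auto simp: scalar_prod_def S'_def atLeast0LessThan intro!: sum.cong)
    also have "\<dots> = (\<Sum>l<Suc N. (if l = j then coeff (R' i) (N - l) else 0)
        + (if j = Suc l then - a * coeff (R' i) (N - l) else 0))"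
      using j by (intro sum.cong) (auto simp: T_def)
    also have "\<dots> = coeff (R' i) (N - j) - (if j = 0 then 0 else a * coeff (R' i) (N - (j - 1)))"
    proof -
      have "(\<Sum>l<Suc N. if j = Suc l then - a * coeff (R' i) (N - l) else 0)
          = (if j = 0 then 0 else - a * coeff (R' i) (N - (j - 1)))"
      proof (cases j)
        case (Suc j')
        hence "(\<Sum>l<Suc N. if j = Suc l then - a * coeff (R' i) (N - l) else 0)
          = (\<Sum>l<Suc N. if l = j' then - a * coeff (R' i) (N - l) else 0)"
          by (intro sum.cong) auto
        thus ?thesis using Suc j by (simp add: sum.delta del: sum.lessThan_Suc)
      qed (simp del: sum.lessThan_Suc)
      thus ?thesis using j by (simp add: sum.distrib sum.delta del: sum.lessThan_Suc)
    qed
    \<comment> \<open>Column 0 has no left neighbour; the term standing in for it is the coefficient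
      of \<open>x^(N + 1)\<close>, which is zero by \<open>degR'\<close>.\<close>
    also have "\<dots> = coeff (R' i) (N - j) - a * coeff (R' i) (Suc (N - j))"
      using degR'[OF i] j by (auto simp: coeff_eq_0 Suc_diff_le)
    also have "\<dots> = coeff (R i) (N - j) - (if n \<le> i \<and> i < N then a * coeff (R (Suc i)) (N - j) else 0)"
    proof -
      consider "i < n" | "n \<le> i" "i < N" | "i = N" "n \<le> i" using i by (force simp: N_def)
      thus ?thesis
      proof cases
        case 1
        have "R i = R' i - Polynomial.smult a (monom 1 (n - Suc i) * f)"
          using 1 by (simp add: R_def R'_def h_def algebra_simps)
        thus ?thesis using 1 by (simp add: R'_def)
      next
        case 2
        have "monom 1 (N - i) = pCons 0 (monom (1::'a) (N - Suc i))"
          using 2 by (metis Suc_diff_Suc monom_Suc)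
        hence "R i = pCons 0 (monom 1 (N - Suc i) * g)"
          using 2 by (simp add: R_def)
        thus ?thesis using 2 by (simp add: R'_def R_def)
      next
        case 3
        have "pCons (poly g a) q - Polynomial.smult a q = g"
          using g_eq by (simp add: algebra_simps)
        hence "coeff g (N - j) = coeff (pCons (poly g a) q) (N - j) - a * coeff q (N - j)"
          by (metis coeff_diff coeff_smult)
        thus ?thesis using 3 by (simp add: R'_def R_def)
      qed
    qed
    also have "\<dots> = (\<Sum>l<Suc N. (if l = i then coeff (R l) (N - j) else 0)
        + (if l = Suc i \<and> n \<le> i then - a * coeff (R l) (N - j) else 0))"
    proof -
      have "(\<Sum>l<Suc N. if l = Suc i \<and> n \<le> i then - a * coeff (R l) (N - j) else 0)
         = (if n \<le> i \<and> i < N then - a * coeff (R (Suc i)) (N - j) else 0)"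
        by (cases "n \<le> i") (auto simp: sum.delta simp del: sum.lessThan_Suc)
      thus ?thesis using i by (simp add: sum.distrib sum.delta del: sum.lessThan_Suc)
    qed
    also have "\<dots> = (\<Sum>l<Suc N. L $$ (i, l) * S $$ (l, j))"
      using i j by (intro sum.cong) (auto simp: L_def S_index)
    also have "\<dots> = (L * S) $$ (i, j)"
      using i j L S by (auto simp: scalar_prod_def atLeast0LessThan intro!: sum.cong)
    finally show "(S' * T) $$ (i, j) = (L * S) $$ (i, j)" .
  qed (use S S' L T in auto)
  hence "det S' = det S"
    using det_mult[OF S' T] det_mult[OF L S] detT detL by simp
  \<comment> \<open>The last column holds the constant terms of the \<open>R' i\<close>, which
    vanish except for \<open>g(a)\<close> in the last row. Deleting this row and column amounts to
    dividing the other rows by \<open>x\<close>.\<close>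
  also have "det S' = (\<Sum>i<Suc N. S' $$ (i, N) * cofactor S' i N)"
    using laplace_expansion_column[OF S', of N] by simp
  also have "\<dots> = (\<Sum>i<Suc N. if i = N then poly g a * cofactor S' N N else 0)"
    by (intro sum.cong) (auto simp: S'_def R'_def N_def)
  also have "\<dots> = poly g a * cofactor S' N N"
    by (simp add: sum.delta del: sum.lessThan_Suc)
  also have "cofactor S' N N = det (mat_delete S' N N)"
    by (simp add: cofactor_def)
  also have "mat_delete S' N N = sylvester_mat f g"
  proof (rule eq_matI)
    fix i j assume "i < dim_row (sylvester_mat f g)" "j < dim_col (sylvester_mat f g)"
    hence i: "i < N" and j: "j < N" by (auto simp: N_def k_def n_def)
    have "mat_delete S' N N $$ (i, j) = coeff (R' i) (N - j)"
      using i j S' by (simp add: mat_delete_def S'_def)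
    moreover have "N - j = Suc (N - Suc j)" using j by simp
    ultimately show "mat_delete S' N N $$ (i, j) = sylvester_mat f g $$ (i, j)"
      using i j unfolding R'_def N_def n_def k_def
      by (subst sylvester_index_mat) (auto simp: coeff_monom_mult coeff_eq_0)
  qed (use S' in \<open>auto simp: mat_delete_def N_def k_def n_def\<close>)
  finally show ?thesis
    by (simp add: S_def h_def resultant_def)
qed

section \<open>Isomorphisms and minimality\<close>

lemma poly_eq_sum_coeff:
  fixes p :: "'a :: comm_semiring_1 poly"
  assumes "degree p \<le> n"
  shows "poly p x = (\<Sum>i\<le>n. coeff p i * x ^ i)"
  unfolding poly_altdef using assms
  by (intro sum.mono_neutral_left) (auto simp: coeff_eq_0)

text \<open>Away from its pole the homogenised substitution is a Moebius pull-back, so changes of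
  variable can be checked on values instead of coefficients.\<close>

lemma poly_hsubst:
  assumes "degree p \<le> n" and "c * x + d \<noteq> 0"
  shows "poly (hsubst n p a b c d) x = (c * x + d) ^ n * poly p ((a * x + b) / (c * x + d))"
proof -
  have "poly (hsubst n p a b c d) x
      = (\<Sum>i\<le>n. coeff p i * ((a * x + b) ^ i * (c * x + d) ^ (n - i)))"
    unfolding hsubst_def by (simp add: poly_sum algebra_simps)
  also have "\<dots> = (\<Sum>i\<le>n. (c * x + d) ^ n * (coeff p i * ((a * x + b) / (c * x + d)) ^ i))"
  proof (intro sum.cong refl)
    fix i assume "i \<in> {..n}"
    hence "(c * x + d) ^ n = (c * x + d) ^ (n - i) * (c * x + d) ^ i"
      by (simp flip: power_add)
    thus "coeff p i * ((a * x + b) ^ i * (c * x + d) ^ (n - i))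
        = (c * x + d) ^ n * (coeff p i * ((a * x + b) / (c * x + d)) ^ i)"
      using assms(2) by (simp add: field_simps)
  qed
  also have "\<dots> = (c * x + d) ^ n * poly p ((a * x + b) / (c * x + d))"
    by (simp add: poly_eq_sum_coeff[OF assms(1)] sum_distrib_left)
  finally show ?thesis .
qed

lemma degree_hsubst_le: "degree (hsubst n p a b c d) \<le> n"
  unfolding hsubst_def
proof (intro degree_sum_le)
  fix i assume i: "i \<in> {..n}"
  have "degree ([:b, a:] ^ i * [:d, c:] ^ (n - i)) \<le> degree ([:b, a:] ^ i) + degree ([:d, c:] ^ (n - i))"
    by (rule degree_mult_le)
  also have "\<dots> \<le> i + (n - i)"
    by (intro add_mono order.trans[OF degree_power_le]) (auto simp: degree_pCons_eq_if)
  finally show "degree (Polynomial.smult (coeff p i) ([:b, a:] ^ i * [:d, c:] ^ (n - i))) \<le> n"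
    using i by (intro order.trans[OF degree_smult_le]) auto
qed simp

text \<open>Allows Moebius identities to be verified off a finite set of poles.\<close>

lemma poly_eqI_cofinite:
  fixes p q :: "rat poly"
  assumes "finite A" and "\<And>x. x \<notin> A \<Longrightarrow> poly p x = poly q x"
  shows "p = q"
proof (rule ccontr)
  assume "p \<noteq> q"
  hence "finite {x. poly (p - q) x = 0}" by (intro poly_roots_finite) simp
  moreover have "- A \<subseteq> {x. poly (p - q) x = 0}" using assms(2) by auto
  ultimately have "finite (- A)" by (rule finite_subset[rotated])
  with assms(1) show False
    by (metis finite_Un Compl_partition infinite_UNIV_char_0)
qed

lemma finite_linear_roots:
  fixes c d :: rat
  assumes "c \<noteq> 0 \<or> d \<noteq> 0"
  shows "finite {x. c * x + d = 0}"
proof -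
  have "finite {x. poly [:d, c:] x = 0}" using assms by (intro poly_roots_finite) auto
  thus ?thesis by (simp add: algebra_simps)
qed

text \<open>\<open>H\<close> drops out because
  \<open>4 (P - H (H + Q)) + (2 H + Q)^2 = 4 P + Q^2\<close>.\<close>

lemma weq_F_transform:
  assumes "e \<noteq> 0"
  shows "weq_F (weq_transform E a b c d e H)
       = Polynomial.smult (1 / e\<^sup>2) (Polynomial.smult 4 (hsubst 6 (fst E) a b c d) + (hsubst 3 (snd E) a b c d)\<^sup>2)"
  using assms unfolding weq_F_def weq_transform_def Let_def
  by (intro poly_ext) (simp add: field_simps power2_eq_square)

text \<open>Completing the square: the isomorphism class only depends on \<open>4 P + Q\<^sup>2\<close>, since \<open>H\<close>
  can be chosen to produce any prescribed \<open>Q\<close>.\<close>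

lemma weq_iso_iff:
  assumes "degree (fst E) \<le> 6" "degree (snd E) \<le> 3"
  shows "weq_iso E E' \<longleftrightarrow> degree (snd E') \<le> 3 \<and>
    (\<exists>a b c d e A. a * d - b * c \<noteq> 0 \<and> e \<noteq> 0 \<and> finite A \<and> (\<forall>x. x \<notin> A \<longrightarrow>
       e\<^sup>2 * poly (weq_F E') x = (c * x + d) ^ 6 * poly (weq_F E) ((a * x + b) / (c * x + d))))"
proof
  assume "weq_iso E E'"
  then obtain a b c d e H where *: "a * d - b * c \<noteq> 0" "e \<noteq> 0" "degree H \<le> 3"
    and E': "E' = weq_transform E a b c d e H" unfolding weq_iso_def by blast
  have "degree (Polynomial.smult 2 H + hsubst 3 (snd E) a b c d) \<le> 3"
    using *(3) degree_hsubst_le by (intro degree_add_le) auto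
  hence "degree (snd E') \<le> 3"
    unfolding E' weq_transform_def Let_def using *(2) by simp
  moreover have "e\<^sup>2 * poly (weq_F E') x = (c * x + d) ^ 6 * poly (weq_F E) ((a * x + b) / (c * x + d))"
    if "x \<notin> {x. c * x + d = 0}" for x
    using that *(2) assms unfolding E' weq_F_transform[OF *(2)]
    by (simp add: poly_hsubst weq_F_def algebra_simps flip: power_mult)
  moreover have "finite {x. c * x + d = 0}" using *(1) by (intro finite_linear_roots) auto
  ultimately show "degree (snd E') \<le> 3 \<and> (\<exists>a b c d e A. a * d - b * c \<noteq> 0 \<and> e \<noteq> 0 \<and> finite A \<and> (\<forall>x. x \<notin> A \<longrightarrow>
       e\<^sup>2 * poly (weq_F E') x = (c * x + d) ^ 6 * poly (weq_F E) ((a * x + b) / (c * x + d))))"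
    using * by blast
next
  assume "degree (snd E') \<le> 3 \<and> (\<exists>a b c d e A. a * d - b * c \<noteq> 0 \<and> e \<noteq> 0 \<and> finite A \<and> (\<forall>x. x \<notin> A \<longrightarrow>
       e\<^sup>2 * poly (weq_F E') x = (c * x + d) ^ 6 * poly (weq_F E) ((a * x + b) / (c * x + d))))"
  then obtain a b c d e A where deg: "degree (snd E') \<le> 3" and *: "a * d - b * c \<noteq> 0" "e \<noteq> 0" "finite A"
    "\<And>x. x \<notin> A \<Longrightarrow> e\<^sup>2 * poly (weq_F E') x = (c * x + d) ^ 6 * poly (weq_F E) ((a * x + b) / (c * x + d))"
    by blast
  \<comment> \<open>The solution of \<open>2 H + Qt = e Q'\<close>, where \<open>Qt\<close> is the
    transformed \<open>Q\<close> and \<open>Q'\<close> is \<open>snd E'\<close>.\<close>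
  define H where "H = Polynomial.smult (1 / 2) (Polynomial.smult e (snd E') - hsubst 3 (snd E) a b c d)"
  have "degree H \<le> 3"
    unfolding H_def using deg degree_hsubst_le[of 3 "snd E" a b c d]
    by (intro order.trans[OF degree_smult_le] degree_diff_le) auto
  have snd_eq: "snd (weq_transform E a b c d e H) = snd E'"
    unfolding weq_transform_def Let_def H_def using *(2) by (intro poly_ext) simp
  have F_eq: "weq_F (weq_transform E a b c d e H) = weq_F E'"
  proof (rule poly_eqI_cofinite)
    show "finite (A \<union> {x. c * x + d = 0})"
      using * by (intro finite_UnI finite_linear_roots) auto
    fix x assume x: "x \<notin> A \<union> {x. c * x + d = 0}"
    hence "e\<^sup>2 * poly (weq_F (weq_transform E a b c d e H)) x = e\<^sup>2 * poly (weq_F E') x"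
      using assms *(2) *(4)[of x] unfolding weq_F_transform[OF *(2)]
      by (simp add: poly_hsubst weq_F_def algebra_simps flip: power_mult)
    thus "poly (weq_F (weq_transform E a b c d e H)) x = poly (weq_F E') x" using *(2) by simp
  qed
  have "Polynomial.smult 4 (fst (weq_transform E a b c d e H)) = Polynomial.smult 4 (fst E')"
    using F_eq snd_eq unfolding weq_F_def by simp
  hence "fst (weq_transform E a b c d e H) = fst E'"
    by (metis smult_eq_iff zero_neq_numeral)
  hence "E' = weq_transform E a b c d e H" using snd_eq by (simp add: prod_eq_iff)
  thus "weq_iso E E'" unfolding weq_iso_def using * \<open>degree H \<le> 3\<close> by blast
qed

text \<open>The case \<open>e = 1\<close>, with the pole as exceptional set. All explicit maps below
  have this form.\<close>

lemma weq_isoI: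
  assumes "degree (fst E) \<le> 6" "degree (snd E) \<le> 3" "degree (snd E') \<le> 3"
    and "a * d - b * c \<noteq> 0"
    and "\<And>x. c * x + d \<noteq> 0 \<Longrightarrow>
      poly (weq_F E') x = (c * x + d) ^ 6 * poly (weq_F E) ((a * x + b) / (c * x + d))"
  shows "weq_iso E E'"
  unfolding weq_iso_iff[OF assms(1,2)] using assms
  by (intro conjI exI[of _ a] exI[of _ b] exI[of _ c] exI[of _ d] exI[of _ 1]
      exI[of _ "{x. c * x + d = 0}"] finite_linear_roots) auto

text \<open>The Moebius matrices and the scale factors multiply. The work lies in keeping the
  exceptional set of the composite finite.\<close>

lemma weq_iso_trans:
  assumes "degree (fst E) \<le> 6" "degree (snd E) \<le> 3" "degree (fst E') \<le> 6"
    and "weq_iso E E'" "weq_iso E' E''"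
  shows "weq_iso E E''"
proof -
  have deg': "degree (snd E') \<le> 3" using assms weq_iso_iff by blast
  obtain a b c d e A where 1: "a * d - b * c \<noteq> 0" "e \<noteq> 0" "finite A"
    "\<And>x. x \<notin> A \<Longrightarrow> e\<^sup>2 * poly (weq_F E') x = (c * x + d) ^ 6 * poly (weq_F E) ((a * x + b) / (c * x + d))"
    using assms(4) unfolding weq_iso_iff[OF assms(1,2)] by blast
  obtain a' b' c' d' e' A' where 2: "a' * d' - b' * c' \<noteq> 0" "e' \<noteq> 0" "finite A'"
    "\<And>x. x \<notin> A' \<Longrightarrow> e'\<^sup>2 * poly (weq_F E'') x = (c' * x + d') ^ 6 * poly (weq_F E') ((a' * x + b') / (c' * x + d'))"
    and deg'': "degree (snd E'') \<le> 3"
    using assms(5) unfolding weq_iso_iff[OF assms(3) deg'] by blast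
  \<comment> \<open>Points to avoid: the bad points and the pole of the inner map, the preimages
    under it of the bad points of the outer map, and the pole of the composite.\<close>
  define B where "B = A' \<union> {x. c' * x + d' = 0} \<union> (\<Union>y\<in>A. {x. (a' - y * c') * x + (b' - y * d') = 0})
    \<union> {x. (c * a' + d * c') * x + (c * b' + d * d') = 0}"
  have fin: "finite B"
    unfolding B_def
  proof (intro finite_UnI finite_UN_I finite_linear_roots 1(3) 2(3))
    show "c' \<noteq> 0 \<or> d' \<noteq> 0" using 2(1) by auto
    show "a' - y * c' \<noteq> 0 \<or> b' - y * d' \<noteq> 0" for y
    proof (rule ccontr)
      assume "\<not> ?thesis"
      hence "a' = y * c'" "b' = y * d'" by auto
      thus False using 2(1) by simp
    qed
    show "c * a' + d * c' \<noteq> 0 \<or> c * b' + d * d' \<noteq> 0"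
    proof (rule ccontr)
      assume "\<not> ?thesis"
      hence 0: "c * a' + d * c' = 0" "c * b' + d * d' = 0" by auto
      \<comment> \<open>The row \<open>(c, d)\<close> times the inner matrix vanishes; multiplying
        by the adjugate recovers \<open>(c, d)\<close> up to the nonzero determinant.\<close>
      have "c * (a' * d' - b' * c') = d' * (c * a' + d * c') - c' * (c * b' + d * d')"
        "d * (a' * d' - b' * c') = a' * (c * b' + d * d') - b' * (c * a' + d * c')"
        by (simp_all add: algebra_simps)
      hence "c = 0" "d = 0" using 0 2(1) by auto
      thus False using 1(1) by simp
    qed
  qed
  have eq: "(e * e')\<^sup>2 * poly (weq_F E'') x
      = ((c * a' + d * c') * x + (c * b' + d * d')) ^ 6
        * poly (weq_F E) (((a * a' + b * c') * x + (a * b' + b * d')) / ((c * a' + d * c') * x + (c * b' + d * d')))"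
    if x: "x \<notin> B" for x
  proof -
    define y where "y = (a' * x + b') / (c' * x + d')"
    have nz: "c' * x + d' \<noteq> 0" and nz2: "(c * a' + d * c') * x + (c * b' + d * d') \<noteq> 0"
      and xA': "x \<notin> A'" using x by (auto simp: B_def)
    have "y \<notin> A"
    proof
      assume "y \<in> A"
      moreover have "(a' - y * c') * x + (b' - y * d') = 0"
        using nz by (simp add: y_def field_simps)
      ultimately show False using x by (auto simp: B_def)
    qed
    have c: "c * y + d = ((c * a' + d * c') * x + (c * b' + d * d')) / (c' * x + d')"
      and a: "a * y + b = ((a * a' + b * c') * x + (a * b' + b * d')) / (c' * x + d')"
      using nz by (simp_all add: y_def field_simps)
    have "(e * e')\<^sup>2 * poly (weq_F E'') x = (c' * x + d') ^ 6 * (e\<^sup>2 * poly (weq_F E') y)"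
      using 2(4)[OF xA'] by (simp add: y_def power_mult_distrib algebra_simps)
    also have "\<dots> = ((c' * x + d') * (c * y + d)) ^ 6 * poly (weq_F E) ((a * y + b) / (c * y + d))"
      using 1(4)[OF \<open>y \<notin> A\<close>] by (simp add: power_mult_distrib)
    also have "(c' * x + d') * (c * y + d) = (c * a' + d * c') * x + (c * b' + d * d')"
      unfolding c using nz by simp
    also have "(a * y + b) / (c * y + d) = ((a * a' + b * c') * x + (a * b' + b * d')) / ((c * a' + d * c') * x + (c * b' + d * d'))"
      unfolding c a using nz nz2 by simp
    finally show ?thesis .
  qed
  have "(a * a' + b * c') * (c * b' + d * d') - (a * b' + b * d') * (c * a' + d * c')
      = (a * d - b * c) * (a' * d' - b' * c')" by (simp add: algebra_simps)
  hence det: "(a * a' + b * c') * (c * b' + d * d') - (a * b' + b * d') * (c * a' + d * c') \<noteq> 0"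
    using 1(1) 2(1) by simp
  show ?thesis
    unfolding weq_iso_iff[OF assms(1,2)]
    using deg'' det fin eq 1(2) 2(2)
    by (intro conjI exI[of _ "a * a' + b * c'"] exI[of _ "a * b' + b * d'"] exI[of _ "c * a' + d * c'"]
      exI[of _ "c * b' + d * d'"] exI[of _ "e * e'"] exI[of _ B]) auto
qed

text \<open>Minimality of \<open>E\<close> is a comparison with all models isomorphic to
  \<open>E\<close>, and by transitivity these include all models of \<open>E'\<close>. Equality of
  the discriminants then suffices.\<close>

lemma globally_minimal_transfer:
  assumes "degree (fst E) \<le> 6" "degree (snd E) \<le> 3" "degree (fst E') \<le> 6"
    and "weq_iso E E'" "weq_disc E' = weq_disc E" "integral_weq E'" "globally_minimal E"
  shows "globally_minimal E'"
  unfolding globally_minimal_def minimal_at_def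
proof (intro allI impI conjI)
  fix p :: nat and E'' :: weq assume p: "prime p" and E'': "weq_iso E' E'' \<and> loc_integral_weq p E''"
  hence "weq_iso E E''" using weq_iso_trans[OF assms(1-4)] by blast
  thus "rat_val p (weq_disc E') \<le> rat_val p (weq_disc E'')"
    using assms(5,7) p E'' unfolding globally_minimal_def minimal_at_def by metis
qed (use assms in auto)

section \<open>Discriminants\<close>

text \<open>The fundamental theorem of algebra is applied to the cubic and then to its quotient by
  \<open>X - \<alpha>\<close>; the third root comes from the sum of the roots.\<close>

lemma complex_cubic_splits:
  fixes a b c :: complex
  obtains \<alpha> \<beta> \<gamma> where "a = - (\<alpha> + \<beta> + \<gamma>)" "b = \<alpha> * \<beta> + \<beta> * \<gamma> + \<gamma> * \<alpha>" "c = - (\<alpha> * \<beta> * \<gamma>)"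
proof -
  have "\<not> constant (poly [:c, b, a, 1:])" by (simp add: constant_degree)
  then obtain \<alpha> where \<alpha>: "poly [:c, b, a, 1:] \<alpha> = 0" using fundamental_theorem_of_algebra by blast
  have "\<not> constant (poly [:b + \<alpha> * (a + \<alpha>), a + \<alpha>, 1:])" by (simp add: constant_degree)
  then obtain \<beta> where \<beta>: "poly [:b + \<alpha> * (a + \<alpha>), a + \<alpha>, 1:] \<beta> = 0"
    using fundamental_theorem_of_algebra by blast
  have "b + \<alpha> * (a + \<alpha>) + \<beta> * (a + \<alpha> + \<beta>) = 0" using \<beta> by simp
  hence b: "b = - (\<alpha> * (a + \<alpha>) + \<beta> * (a + \<alpha> + \<beta>))" by Groebner_Basis.algebra
  have "c + \<alpha> * (b + \<alpha> * (a + \<alpha>)) = 0" using \<alpha> by simp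
  hence c: "c = - \<alpha> * (b + \<alpha> * (a + \<alpha>))" by Groebner_Basis.algebra
  show thesis
    by (rule that[of \<alpha> \<beta> "- (a + \<alpha>) - \<beta>"]) (simp_all add: c b algebra_simps)
qed

lemma poly_pderiv_mult_linear:
  fixes p :: "'a :: idom poly"
  shows "poly (pderiv ([:- a, 1:] * p)) a = poly p a"
  by (simp add: pderiv_mult pderiv_pCons del: mult_pCons_left)

text \<open>Over the complex numbers, peeling off linear factors expresses the resultant of
  \<open>G\<close> and \<open>G'\<close> through the values of \<open>G'\<close> at the five roots.
  These are products of root differences, and Vieta's formulas lead back to \<open>A\<close>,
  \<open>B\<close>, \<open>C\<close>.\<close>

lemma weq_disc_two_roots:
  assumes F: "\<And>x. poly (weq_F E) x = 4 * (x - r) * (x - r - s) * ((x - r) ^ 3 + A * (x - r)\<^sup>2 + B * (x - r) + C)"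
  shows "weq_disc E = 256 * s\<^sup>2 * C\<^sup>2 * (s ^ 3 + A * s\<^sup>2 + B * s + C)\<^sup>2
    * (A\<^sup>2 * B\<^sup>2 - 4 * B ^ 3 - 4 * A ^ 3 * C - 27 * C\<^sup>2 + 18 * A * B * C)"
proof -
  obtain \<alpha> \<beta> \<gamma> :: complex where abc: "of_rat A = - (\<alpha> + \<beta> + \<gamma>)" "of_rat B = \<alpha> * \<beta> + \<beta> * \<gamma> + \<gamma> * \<alpha>"
    "of_rat C = - (\<alpha> * \<beta> * \<gamma>)" by (rule complex_cubic_splits)
  define G :: "complex poly" where "G = map_poly of_rat (weq_F E)"
  define u v where "u = (of_rat r :: complex)" and "v = (of_rat s :: complex)"
  have F_eq: "weq_F E = [:- r, 1:] * ([:- (r + s), 1:] *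
      [:4 * (C - B * r + A * r\<^sup>2 - r ^ 3), 4 * (B - 2 * A * r + 3 * r\<^sup>2), 4 * (A - 3 * r), 4:])"
    by (intro poly_ext) (simp add: F algebra_simps power2_eq_square power3_eq_cube)
  have G: "G = [:- u, 1:] * ([:- (u + v), 1:] * ([:- (u + \<alpha>), 1:] * ([:- (u + \<beta>), 1:] * ([:- (u + \<gamma>), 1:] * [:4:]))))"
    unfolding G_def F_eq u_def v_def
    by (simp add: hom_distribs abc) (simp add: algebra_simps power2_eq_square power3_eq_cube)
  have degF: "degree (weq_F E) = 5" unfolding F_eq by (simp add: degree_mult_eq)
  have lcF: "lead_coeff (weq_F E) = 4" unfolding F_eq by (simp add: lead_coeff_mult)
  have degG: "degree (pderiv G) = 4" unfolding G_def using degF by (simp add: degree_pderiv)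
  have "of_rat (resultant (weq_F E) (pderiv (weq_F E))) = resultant G (pderiv G)"
    unfolding G_def by (simp add: of_rat_hom.resultant_hom flip: of_rat_hom.map_poly_pderiv)
  \<comment> \<open>After the five linear factors the constant 4 remains; its resultant with
    \<open>G'\<close>, of degree 4, is \<open>4 ^ 4\<close>.\<close>
  also have "\<dots> = poly (pderiv G) u * (poly (pderiv G) (u + v) * (poly (pderiv G) (u + \<alpha>)
      * (poly (pderiv G) (u + \<beta>) * (poly (pderiv G) (u + \<gamma>) * 4 ^ 4))))"
    by (subst (1) G, (subst resultant_mult_linear, simp)+) (simp add: degG)
  also have "poly (pderiv G) u = 4 * v * \<alpha> * \<beta> * \<gamma>"
  proof -
    have "G = [:- u, 1:] * ([:- (u + v), 1:] * ([:- (u + \<alpha>), 1:] * ([:- (u + \<beta>), 1:] * ([:- (u + \<gamma>), 1:] * [:4:]))))"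
      unfolding G by (simp only: mult_ac)
    thus ?thesis by (simp only: poly_pderiv_mult_linear) (simp add: algebra_simps)
  qed
  also have "poly (pderiv G) (u + v) = 4 * v * ((v - \<alpha>) * (v - \<beta>) * (v - \<gamma>))"
  proof -
    have "G = [:- (u + v), 1:] * ([:- u, 1:] * ([:- (u + \<alpha>), 1:] * ([:- (u + \<beta>), 1:] * ([:- (u + \<gamma>), 1:] * [:4:]))))"
      unfolding G by (simp only: mult_ac)
    thus ?thesis by (simp only: poly_pderiv_mult_linear) (simp add: algebra_simps)
  qed
  also have "poly (pderiv G) (u + \<alpha>) = 4 * \<alpha> * (\<alpha> - v) * (\<alpha> - \<beta>) * (\<alpha> - \<gamma>)"
  proof -
    have "G = [:- (u + \<alpha>), 1:] * ([:- u, 1:] * ([:- (u + v), 1:] * ([:- (u + \<beta>), 1:] * ([:- (u + \<gamma>), 1:] * [:4:]))))"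
      unfolding G by (simp only: mult_ac)
    thus ?thesis by (simp only: poly_pderiv_mult_linear) (simp add: algebra_simps)
  qed
  also have "poly (pderiv G) (u + \<beta>) = 4 * \<beta> * (\<beta> - v) * (\<beta> - \<alpha>) * (\<beta> - \<gamma>)"
  proof -
    have "G = [:- (u + \<beta>), 1:] * ([:- u, 1:] * ([:- (u + v), 1:] * ([:- (u + \<alpha>), 1:] * ([:- (u + \<gamma>), 1:] * [:4:]))))"
      unfolding G by (simp only: mult_ac)
    thus ?thesis by (simp only: poly_pderiv_mult_linear) (simp add: algebra_simps)
  qed
  also have "poly (pderiv G) (u + \<gamma>) = 4 * \<gamma> * (\<gamma> - v) * (\<gamma> - \<alpha>) * (\<gamma> - \<beta>)"
  proof -
    have "G = [:- (u + \<gamma>), 1:] * ([:- u, 1:] * ([:- (u + v), 1:] * ([:- (u + \<alpha>), 1:] * ([:- (u + \<beta>), 1:] * [:4:]))))"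
      unfolding G by (simp only: mult_ac)
    thus ?thesis by (simp only: poly_pderiv_mult_linear) (simp add: algebra_simps)
  qed
  also have "4 * v * \<alpha> * \<beta> * \<gamma> * (4 * v * ((v - \<alpha>) * (v - \<beta>) * (v - \<gamma>))
      * (4 * \<alpha> * (\<alpha> - v) * (\<alpha> - \<beta>) * (\<alpha> - \<gamma>) * (4 * \<beta> * (\<beta> - v) * (\<beta> - \<alpha>) * (\<beta> - \<gamma>)
      * (4 * \<gamma> * (\<gamma> - v) * (\<gamma> - \<alpha>) * (\<gamma> - \<beta>) * 4 ^ 4))))
     = 4 ^ 9 * v\<^sup>2 * (- (\<alpha> * \<beta> * \<gamma>))\<^sup>2 * ((v - \<alpha>) * (v - \<beta>) * (v - \<gamma>))\<^sup>2
        * ((\<alpha> - \<beta>) * (\<beta> - \<gamma>) * (\<gamma> - \<alpha>))\<^sup>2"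
  proof -
    \<comment> \<open>Naming the differences and rewriting their opposites as negatives reduces the
      claim to an identity between monomials.\<close>
    define x y z p q w where "x = v - \<alpha>" "y = v - \<beta>" "z = v - \<gamma>" "p = \<alpha> - \<beta>" "q = \<beta> - \<gamma>" "w = \<gamma> - \<alpha>"
    note xyz = this
    have neg: "\<alpha> - v = - x" "\<beta> - v = - y" "\<gamma> - v = - z" "\<beta> - \<alpha> = - p" "\<gamma> - \<beta> = - q" "\<alpha> - \<gamma> = - w"
      unfolding xyz by simp_all
    show ?thesis unfolding neg xyz[symmetric] by Groebner_Basis.algebra
  qed
  also have "(v - \<alpha>) * (v - \<beta>) * (v - \<gamma>) = of_rat (s ^ 3 + A * s\<^sup>2 + B * s + C)"
    unfolding of_rat_add of_rat_mult of_rat_power abc v_def[symmetric]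
    by (simp add: power2_eq_square power3_eq_cube algebra_simps)
  also have "- (\<alpha> * \<beta> * \<gamma>) = of_rat C" by (simp add: abc)
  also have "((\<alpha> - \<beta>) * (\<beta> - \<gamma>) * (\<gamma> - \<alpha>))\<^sup>2
     = of_rat (A\<^sup>2 * B\<^sup>2 - 4 * B ^ 3 - 4 * A ^ 3 * C - 27 * C\<^sup>2 + 18 * A * B * C)"
    unfolding of_rat_add of_rat_diff of_rat_mult of_rat_power abc of_rat_numeral_eq by Groebner_Basis.algebra
  finally have "of_rat (resultant (weq_F E) (pderiv (weq_F E)))
     = (of_rat (4 ^ 9 * s\<^sup>2 * C\<^sup>2 * (s ^ 3 + A * s\<^sup>2 + B * s + C)\<^sup>2
        * (A\<^sup>2 * B\<^sup>2 - 4 * B ^ 3 - 4 * A ^ 3 * C - 27 * C\<^sup>2 + 18 * A * B * C)) :: complex)"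
    unfolding v_def by (simp add: of_rat_mult of_rat_power)
  hence "resultant (weq_F E) (pderiv (weq_F E))
     = 4 ^ 9 * s\<^sup>2 * C\<^sup>2 * (s ^ 3 + A * s\<^sup>2 + B * s + C)\<^sup>2
        * (A\<^sup>2 * B\<^sup>2 - 4 * B ^ 3 - 4 * A ^ 3 * C - 27 * C\<^sup>2 + 18 * A * B * C)"
    by (simp only: of_rat_eq_iff)
  moreover have "weq_F E \<noteq> 0" using degF by auto
  moreover have "coeff (weq_F E) 5 = 4" using lcF degF by simp
  \<comment> \<open>The root at infinity contributes \<open>4 ^ 2\<close> to the sextic form
    discriminant, and \<open>4 ^ 2 * 4 ^ 9 / 4 / 2 ^ 12 = 256\<close>.\<close>
  ultimately show ?thesis
    unfolding weq_disc_def form_disc_def poly_disc_def Let_def degF by simp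
qed

text \<open>Absorbing the leading 4 into the cubic allows integral coefficients. The last factor is
  the discriminant of \<open>4 z^3 + a z^2 + b z + c\<close>; the square contains the values of this
  cubic at both roots.\<close>

lemma weq_disc_integer_roots:
  assumes "\<And>x. poly (weq_F E) x = (x - r) * (x - r - s) * (4 * (x - r) ^ 3 + a * (x - r)\<^sup>2 + b * (x - r) + c)"
  shows "256 * weq_disc E = (s * c * (4 * s ^ 3 + a * s\<^sup>2 + b * s + c))\<^sup>2
    * (a\<^sup>2 * b\<^sup>2 - 16 * b ^ 3 - 4 * a ^ 3 * c - 432 * c\<^sup>2 + 72 * a * b * c)"
proof -
  have "weq_disc E = 256 * s\<^sup>2 * (c / 4)\<^sup>2 * (s ^ 3 + a / 4 * s\<^sup>2 + b / 4 * s + c / 4)\<^sup>2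
    * ((a / 4)\<^sup>2 * (b / 4)\<^sup>2 - 4 * (b / 4) ^ 3 - 4 * (a / 4) ^ 3 * (c / 4) - 27 * (c / 4)\<^sup>2 + 18 * (a / 4) * (b / 4) * (c / 4))"
    by (rule weq_disc_two_roots[of E r s]) (simp add: assms field_simps)
  thus ?thesis by (simp add: field_simps power2_eq_square power3_eq_cube)
qed

text \<open>Here the roots differ by \<open>u / 4\<close>, and the long factor in the square is 64
  times the value of the cubic at the second one.\<close>

lemma weq_disc_quarter_root:
  assumes "\<And>x. poly (weq_F E) x = (x - r) * (4 * (x - r) - u) * ((x - r) ^ 3 + a * (x - r)\<^sup>2 + b * (x - r) + c)"
  shows "256 * weq_disc E = (u * c * (u ^ 3 + 4 * a * u\<^sup>2 + 16 * b * u + 64 * c))\<^sup>2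
    * (a\<^sup>2 * b\<^sup>2 - 4 * b ^ 3 - 4 * a ^ 3 * c - 27 * c\<^sup>2 + 18 * a * b * c)"
proof -
  have "weq_disc E = 256 * (u / 4)\<^sup>2 * c\<^sup>2 * ((u / 4) ^ 3 + a * (u / 4)\<^sup>2 + b * (u / 4) + c)\<^sup>2
    * (a\<^sup>2 * b\<^sup>2 - 4 * b ^ 3 - 4 * a ^ 3 * c - 27 * c\<^sup>2 + 18 * a * b * c)"
    by (rule weq_disc_two_roots[of E r "u / 4"]) (simp add: assms field_simps)
  moreover have "(u / 4) ^ 3 + a * (u / 4)\<^sup>2 + b * (u / 4) + c = (u ^ 3 + 4 * a * u\<^sup>2 + 16 * b * u + 64 * c) / 64"
    by (simp add: field_simps power2_eq_square power3_eq_cube)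
  ultimately show ?thesis by (simp only: power_mult_distrib power_divide) simp
qed

section \<open>Arithmetic of the cubic cofactor\<close>

lemma dvd_16_cases:
  fixes n :: int
  assumes "n dvd 16"
  shows "n = 1 \<or> n = 2 \<or> n = 4 \<or> n = 8 \<or> n = 16 \<or> n = -1 \<or> n = -2 \<or> n = -4 \<or> n = -8 \<or> n = -16"
proof -
  have "nat \<bar>n\<bar> dvd 2 ^ 4" using assms by (simp add: nat_dvd_iff)
  then obtain i where i: "i \<le> 4" "nat \<bar>n\<bar> = 2 ^ i"
    using divides_primepow_nat[OF two_is_prime_nat] by blast
  hence "i = 0 \<or> i = 1 \<or> i = 2 \<or> i = 3 \<or> i = 4" by auto
  hence "\<bar>n\<bar> = 1 \<or> \<bar>n\<bar> = 2 \<or> \<bar>n\<bar> = 4 \<or> \<bar>n\<bar> = 8 \<or> \<bar>n\<bar> = 16"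
    using i(2) by (elim disjE) (simp_all add: nat_eq_iff)
  thus ?thesis by arith
qed

text \<open>Write \<open>n = 2 ^ k * m\<close> with \<open>m\<close> odd. Then \<open>m^2\<close>
  divides the squarefree \<delta>, so \<open>m\<close> is a unit, while \<open>2 ^ (2 * k)\<close>
  is coprime to the odd \<delta> and divides \<open>2 ^ 8\<close>.\<close>

lemma square_dvd_256_squarefree:
  fixes n \<delta> :: int
  assumes "n\<^sup>2 dvd 256 * \<delta>" "squarefree \<delta>" "odd \<delta>"
  shows "n dvd 16"
proof -
  have "n \<noteq> 0" using assms by auto
  then obtain k m where n: "n = 2 ^ k * m" and m: "odd m"
    by (rule multiplicity_decompose'[of n 2]) auto
  have "m\<^sup>2 dvd 256 * \<delta>" using assms(1) unfolding n power_mult_distrib by (rule dvd_mult_right)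
  moreover have "coprime (m\<^sup>2) (256 :: int)"
  proof -
    have "coprime m 2" using m by simp
    hence "coprime (m\<^sup>2) ((2::int) ^ 8)"
      by (simp only: coprime_power_left_iff coprime_power_right_iff simp_thms)
    thus ?thesis by simp
  qed
  ultimately have "m\<^sup>2 dvd \<delta>" by (simp add: coprime_dvd_mult_right_iff)
  hence m1: "m dvd 1" using assms(2) by (rule squarefreeD[rotated])
  have "(2 ^ k)\<^sup>2 dvd 256 * \<delta>" using assms(1) unfolding n power_mult_distrib by (rule dvd_mult_left)
  hence "2 ^ (2 * k) dvd 2 ^ 8 * \<delta>" by (simp add: power_even_eq)
  moreover have "coprime (2 ^ (2 * k)) \<delta>" using assms(3) by simp
  ultimately have "(2::int) ^ (2 * k) dvd 2 ^ 8" by (simp add: coprime_dvd_mult_left_iff)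
  hence "(2::int) ^ (2 * k) \<le> 2 ^ 8" by (rule zdvd_imp_le) simp
  hence "2 * k \<le> 8" by (rule power_le_imp_le_exp[rotated]) simp
  hence "(2::int) ^ k dvd 2 ^ 4" by (intro le_imp_power_dvd) simp
  hence "2 ^ k * m dvd 16 * 1" using m1 by (intro mult_dvd_mono) simp_all
  thus ?thesis unfolding n by simp
qed

text \<open>Each case names the quotient of \<open>q^2\<close> by 4 as a new variable, which makes
  later congruences linear.\<close>

lemma square_mod_4:
  fixes q :: int
  obtains (even) k m where "q = 2 * k" "q\<^sup>2 = 4 * m" | (odd) k m where "q = 2 * k + 1" "q\<^sup>2 = 4 * m + 1"
proof (cases "even q")
  case True
  then obtain k where "q = 2 * k" by blast
  thus ?thesis by (intro even[of k "k\<^sup>2"]) (auto simp: power2_eq_square)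
next
  case False
  then obtain k where "q = 2 * k + 1" by (elim oddE)
  thus ?thesis by (intro odd[of k "k\<^sup>2 + k"]) (auto simp: power2_eq_square algebra_simps)
qed

text \<open>The equations \<open>f0\<close> to \<open>f4\<close> compare coefficients of
  \<open>4 P + Q^2\<close> and \<open>z (z - s) (4 z^3 + a z^2 + b z + c)\<close>; \<open>h\<close>
  is the value of the cubic at \<open>s\<close>, and \<open>D\<close> its discriminant. Since
  \<open>s * c * h\<close> divides 16, finitely many \<open>s\<close>, \<open>c\<close>,
  \<open>h\<close> remain, to be sieved modulo 4.\<close>

lemma integer_roots_cases:
  fixes s a b c p0 p1 p2 p3 p4 q0 q1 q2 \<delta> :: int
  defines "h \<equiv> 4 * s ^ 3 + a * s\<^sup>2 + b * s + c"
    and "D \<equiv> a\<^sup>2 * b\<^sup>2 - 16 * b ^ 3 - 4 * a ^ 3 * c - 432 * c\<^sup>2 + 72 * a * b * c"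
  assumes s: "s > 0"
    and f0: "0 = 4 * p0 + q0\<^sup>2"
    and f1: "- s * c = 4 * p1 + 2 * q0 * q1"
    and f2: "c - s * b = 4 * p2 + q1\<^sup>2 + 2 * q0 * q2"
    and f3: "b - s * a = 4 * p3 + 2 * q1 * q2"
    and f4: "a - 4 * s = 4 * p4 + q2\<^sup>2"
    and disc: "256 * \<delta> = (s * c * h)\<^sup>2 * D"
    and \<delta>: "squarefree \<delta>" "odd \<delta>"
  shows "(s = 4 \<and> c = 1 \<and> (\<exists>a'. a = 4 * a' \<and> b = - 64 - 16 * a'))
    \<or> (s = 1 \<and> (\<exists>t. a = 4 * t + 1) \<and> (c = 4 \<and> b = - 4 - a \<or> c = -4 \<and> b = - 4 - a \<or> c = -4 \<and> b = 4 - a))"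
proof -
  have "(s * c * h)\<^sup>2 dvd 256 * \<delta>" by (simp add: disc)
  hence dvd: "s * c * h dvd 16" using \<delta> by (rule square_dvd_256_squarefree)
  have "s dvd 16" "c dvd 16" "h dvd 16"
    using dvd by (auto intro: dvd_mult_left dvd_mult_right)
  note s_cases = dvd_16_cases[OF this(1)] and c_cases = dvd_16_cases[OF this(2)]
    and h_cases = dvd_16_cases[OF this(3)]
  obtain k0 where q0: "q0 = 2 * k0"
  proof (cases q0 rule: square_mod_4)
    case (odd k m)
    thus ?thesis using f0 by presburger
  qed
  have f1': "- s * c = 4 * (p1 + k0 * q1)" and f2': "c - s * b = 4 * (p2 + k0 * q2) + q1\<^sup>2"
    using f1 f2 by (simp_all add: q0 algebra_simps)
  have s_cases': "s = 1 \<or> s = 2 \<or> s = 4 \<or> s = 8 \<or> s = 16" using s s_cases by auto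
  show ?thesis
  proof (cases "s = 1")
    case False
    hence s_even: "even s" using s_cases' by auto
    show ?thesis
    proof (cases q1 rule: square_mod_4)
      case (even k m)
      have "b = s * a + 4 * (p3 + k * q2)" using f3 even by (simp add: algebra_simps)
      hence "even b" using s_even by simp
      hence sb: "4 dvd s * b" using mult_dvd_mono[OF s_even, of 2 b] by simp
      have "c = s * b + 4 * (p2 + k0 * q2 + m)" using f2' even by (simp add: algebra_simps)
      hence c4: "4 dvd c" using sb by (metis dvd_add dvd_triv_left)
      have "4 dvd s\<^sup>2" using s_even mult_dvd_mono[OF s_even s_even] by (simp add: power2_eq_square)
      hence "4 dvd h" unfolding h_def using sb c4 by (intro dvd_add) (auto simp: mult.commute)
      \<comment> \<open>For even \<open>s\<close> and \<open>q1\<close> the product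
        \<open>s * c * h\<close> is too divisible by 2: 32 does not divide 16.\<close>
      hence "2 * 4 * 4 dvd s * c * h" using s_even c4 by (intro mult_dvd_mono)
      hence "2 * 4 * 4 dvd (16::int)" using dvd by (rule dvd_trans)
      thus ?thesis by simp
    next
      case (odd k m)
      have c1: "c - s * b = 4 * (p2 + k0 * q2 + m) + 1" using f2' odd by simp
      \<comment> \<open>For \<open>s = 2\<close>, \<open>f1'\<close> would make \<open>c\<close>
        even, but \<open>c1\<close> makes it odd.\<close>
      have "s \<noteq> 2"
      proof
        assume "s = 2"
        thus False using f1' c1 by simp presburger
      qed
      hence s4: "s = 4 \<or> s = 8 \<or> s = 16" using s_cases' False by auto
      hence "4 dvd s" by auto
      then obtain s' where s': "s = 4 * s'" by blast
      have "c = 1"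
      proof -
        have "c = 4 * (p2 + k0 * q2 + m + s' * b) + 1" using c1 by (simp add: s' algebra_simps)
        \<comment> \<open>Among the divisors of 16 only 1 is congruent to 1 modulo 4; the same
          argument gives \<open>h = 1\<close> below.\<close>
        thus ?thesis using c_cases by presburger
      qed
      have "h = 4 * (s ^ 3 + a * s * s' + b * s') + 1"
        unfolding h_def using \<open>c = 1\<close> by (simp add: s' algebra_simps power2_eq_square)
      hence "h = 1" using h_cases by presburger
      hence "s * (4 * s\<^sup>2 + a * s + b) = 0"
        unfolding h_def using \<open>c = 1\<close> by (simp add: algebra_simps power2_eq_square power3_eq_cube)
      hence root: "4 * s\<^sup>2 + a * s + b = 0" using s by simp
      show ?thesis
      proof (cases q2 rule: square_mod_4)
        case odd2: (odd k' m')
        \<comment> \<open>An odd \<open>q2\<close> would give \<open>b\<close> the residue 2 modulo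
          4, against \<open>root\<close>.\<close>
        have "b = 4 * (s' * a + p3 + 2 * k * k' + k + k') + 2"
          using f3 unfolding s' odd(1) odd2(1) by (simp add: algebra_simps)
        moreover have "b = 4 * (- s\<^sup>2 - a * s')" using root by (simp add: s' algebra_simps)
        ultimately show ?thesis by presburger
      next
        case even2: (even k' m')
        obtain a' where a': "a = 4 * a'" using f4 even2
          by (metis add.commute diff_add_cancel distrib_left)
        have b': "b = 4 * (- s\<^sup>2 - a * s')" using root by (simp add: s' algebra_simps)
        define b' where "b' = - s\<^sup>2 - a * s'"
        define X where "X = 16 * a'\<^sup>2 * b'\<^sup>2 - 64 * b' ^ 3 - 16 * a' ^ 3 - 27 + 72 * a' * b'"
        have D: "D = 16 * X"
          unfolding D_def X_def a' b'[folded b'_def] \<open>c = 1\<close> by (simp add: power_mult_distrib algebra_simps)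
        \<comment> \<open>For \<open>s = 8\<close> or \<open>s = 16\<close> the right side is a
          multiple of 512, so \<delta> would be even.\<close>
        have disc': "256 * \<delta> = s\<^sup>2 * (16 * X)" using disc \<open>h = 1\<close> \<open>c = 1\<close> D by simp
        from s4 show ?thesis
        proof (elim disjE)
          assume "s = 4"
          thus ?thesis using \<open>c = 1\<close> root a' by auto
        next
          assume "s = 8"
          thus ?thesis using disc' \<delta>(2) by simp
        next
          assume "s = 16"
          thus ?thesis using disc' \<delta>(2) by simp
        qed
      qed
    qed
  next
    case True
    have h_eq: "h = 4 + a + b + c" by (simp add: h_def True)
    have c4: "c = 4 * (- p1 - k0 * q1)" using f1' True by simp
    have c_b: "c - b = 4 * (p2 + k0 * q2) + q1\<^sup>2" using f2' True by simp
    have b_a: "b - a = 4 * p3 + 2 * q1 * q2" and a4: "a = 4 + 4 * p4 + q2\<^sup>2" using f3 f4 True by simp_all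
    obtain c' where c': "c = 4 * c'" using c4 by blast
    define X where "X = p2 + k0 * q2"
    have X: "c - b = 4 * X + q1\<^sup>2" using c_b by (simp add: X_def)
    \<comment> \<open>If \<open>q1\<close> and \<open>q2\<close> have different parity,
      \<open>c\<close> is congruent to 1 modulo 4, which \<open>c'\<close> excludes. If both are
      even, \<open>a\<close> and \<open>b\<close> are divisible by 4; if both are odd, they are 1
      and 3 modulo 4. The names \<open>X\<close> and \<open>Y\<close> hide nonlinear terms from
      \<open>presburger\<close>.\<close>
    have *: "4 dvd h \<and> (odd a \<and> odd b \<longrightarrow> (\<exists>t. a = 4 * t + 1))"
    proof (cases q1 rule: square_mod_4; cases q2 rule: square_mod_4)
      fix k m k' m' assume q: "q1 = 2 * k" "q1\<^sup>2 = 4 * m" "q2 = 2 * k'" "q2\<^sup>2 = 4 * m'"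
      define Y where "Y = 2 * k * k'"
      have "b - a = 4 * (p3 + Y)" unfolding b_a Y_def q(1,3) by (simp add: algebra_simps)
      moreover have "c - b = 4 * (X + m)" using X q by simp
      moreover have "a = 4 * (1 + p4 + m')" using a4 q by simp
      ultimately show ?thesis using c' unfolding h_eq by presburger
    next
      fix k m k' m' assume q: "q1 = 2 * k" "q1\<^sup>2 = 4 * m" "q2 = 2 * k' + 1" "q2\<^sup>2 = 4 * m' + 1"
      define Y where "Y = k * q2"
      have "b - a = 4 * (p3 + Y)" unfolding b_a Y_def q(1) by (simp add: algebra_simps)
      moreover have "c - b = 4 * (X + m)" using X q by simp
      moreover have "a = 4 * (1 + p4 + m') + 1" using a4 q by simp
      ultimately show ?thesis using c' unfolding h_eq by presburger
    next
      fix k m k' m' assume q: "q1 = 2 * k + 1" "q1\<^sup>2 = 4 * m + 1" "q2 = 2 * k'" "q2\<^sup>2 = 4 * m'"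
      define Y where "Y = q1 * k'"
      have "b - a = 4 * (p3 + Y)" unfolding b_a Y_def q(3) by (simp add: algebra_simps)
      moreover have "c - b = 4 * (X + m) + 1" using X q by simp
      moreover have "a = 4 * (1 + p4 + m')" using a4 q by simp
      ultimately show ?thesis using c' unfolding h_eq by presburger
    next
      fix k m k' m' assume q: "q1 = 2 * k + 1" "q1\<^sup>2 = 4 * m + 1" "q2 = 2 * k' + 1" "q2\<^sup>2 = 4 * m' + 1"
      define Y where "Y = 2 * k * k' + k + k'"
      have "b - a = 4 * (p3 + Y) + 2" unfolding b_a Y_def q(1,3) by (simp add: algebra_simps)
      moreover have "c - b = 4 * (X + m) + 1" using X q by simp
      moreover have "a = 4 * (1 + p4 + m') + 1" using a4 q by simp
      ultimately show ?thesis using c' unfolding h_eq by presburger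
    qed
    then obtain h' where h': "h = 4 * h'" by (auto elim: dvdE)
    have "16 * (c' * h') dvd 16 * 1" using dvd True by (simp add: c' h')
    hence "c' * h' dvd 1" by (subst (asm) dvd_mult_cancel_left) simp
    hence "c' dvd 1" "h' dvd 1" by (rule dvd_mult_left, rule dvd_mult_right)
    hence ch: "c' = 1 \<or> c' = -1" "h' = 1 \<or> h' = -1" by auto
    have "D = \<delta>" using disc ch by (auto simp: True c' h')
    \<comment> \<open>Modulo 2, \<open>D\<close> is \<open>a^2 * b^2\<close>.\<close>
    have "odd a \<and> odd b"
    proof (rule ccontr)
      assume "\<not> ?thesis"
      hence "even D" unfolding D_def by auto
      thus False using \<open>D = \<delta>\<close> \<delta>(2) by simp
    qed
    hence t: "\<exists>t. a = 4 * t + 1" using * by blast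
    have "\<not> (c' = 1 \<and> h' = -1)"
    proof
      assume "c' = 1 \<and> h' = -1"
      hence c: "c = 4" and b: "b = -12 - a" using h' c' h_eq by auto
      \<comment> \<open>After \<open>z\<close> is replaced by \<open>-z\<close>, the cubic is, up to
        sign, 4 times the simplest cubic \<open>x^3 - n x^2 - (n + 3) x - 1\<close> with
        \<open>n = a / 4\<close>; hence the square discriminant.\<close>
      have "D = (a\<^sup>2 + 12 * a + 144)\<^sup>2"
        unfolding D_def c b by Groebner_Basis.algebra
      hence "a\<^sup>2 + 12 * a + 144 dvd 1" using \<delta>(1) \<open>D = \<delta>\<close> by (intro squarefreeD[of \<delta>]) auto
      moreover have "a\<^sup>2 + 12 * a + 144 = (a + 6)\<^sup>2 + 108" by (simp add: power2_eq_square algebra_simps)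
      ultimately have "(a + 6)\<^sup>2 + 108 dvd 1" by simp
      hence "(a + 6)\<^sup>2 + 108 \<le> 1" by (rule zdvd_imp_le) simp
      thus False using zero_le_power2[of "a + 6"] by linarith
    qed
    thus ?thesis using ch True t h_eq h' c' by auto
  qed
qed

text \<open>The equations now compare \<open>4 P + Q^2\<close> with
  \<open>z (4 z - u) (z^3 + a z^2 + b z + c)\<close>. As \<open>u\<close> and \<open>h\<close> are
  odd divisors of 16, congruences modulo 4 fix both as -1; this gives \<open>a\<close>, and then 4
  divides \<open>a\<close>, \<open>b\<close> and \<open>c\<close>.\<close>

lemma quarter_root_cases:
  fixes u a b c p0 p1 p2 p3 p4 q0 q1 q2 \<delta> :: int
  defines "h \<equiv> u ^ 3 + 4 * a * u\<^sup>2 + 16 * b * u + 64 * c"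
    and "D \<equiv> a\<^sup>2 * b\<^sup>2 - 4 * b ^ 3 - 4 * a ^ 3 * c - 27 * c\<^sup>2 + 18 * a * b * c"
  assumes u: "odd u"
    and f0: "0 = 4 * p0 + q0\<^sup>2"
    and f1: "- u * c = 4 * p1 + 2 * q0 * q1"
    and f2: "4 * c - u * b = 4 * p2 + q1\<^sup>2 + 2 * q0 * q2"
    and f3: "4 * b - u * a = 4 * p3 + 2 * q1 * q2"
    and f4: "4 * a - u = 4 * p4 + q2\<^sup>2"
    and disc: "256 * \<delta> = (u * c * h)\<^sup>2 * D"
    and \<delta>: "squarefree \<delta>" "odd \<delta>"
  shows "u = -1 \<and> (\<exists>b'. b = 4 * b' \<and> (c = 4 \<and> a = 16 * b' - 64 \<or> c = -4 \<and> a = 16 * b' + 64))"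
proof -
  have "(u * c * h)\<^sup>2 dvd 256 * \<delta>" by (simp add: disc)
  hence dvd: "u * c * h dvd 16" using \<delta> by (rule square_dvd_256_squarefree)
  have "u dvd 16" "c dvd 16" "h dvd 16"
    using dvd by (auto intro: dvd_mult_left dvd_mult_right)
  note u_cases = dvd_16_cases[OF this(1)] and c_cases = dvd_16_cases[OF this(2)]
    and h_cases = dvd_16_cases[OF this(3)]
  obtain k0 where q0: "q0 = 2 * k0"
  proof (cases q0 rule: square_mod_4)
    case (odd k m)
    thus ?thesis using f0 by presburger
  qed
  obtain k2 m2 where q2: "q2 = 2 * k2 + 1" "q2\<^sup>2 = 4 * m2 + 1"
  proof (cases q2 rule: square_mod_4)
    case (even k m)
    thus ?thesis using f4 u by presburger
  qed
  have "u = 1 \<or> u = -1" using u_cases u by auto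
  hence u1: "u = -1" using f4 q2(2) by presburger
  have "h = -1 + 4 * (a - 4 * b + 16 * c)" by (simp add: h_def u1)
  \<comment> \<open>The only divisor of 16 congruent to -1 modulo 4 is -1.\<close>
  hence "h = -1" using h_cases by presburger
  hence a: "a = 4 * b - 16 * c" by (simp add: h_def u1)
  obtain k1 m1 where q1: "q1 = 2 * k1" "q1\<^sup>2 = 4 * m1"
  proof (cases q1 rule: square_mod_4)
    case (odd k m)
    have "2 * q1 * q2 = 4 * (2 * k * k2 + k + k2) + 2"
      unfolding odd(1) q2(1) by (simp add: algebra_simps)
    thus ?thesis using f3 a u1 by simp presburger
  qed
  have "c = 4 * (p1 + k0 * q1)" using f1 by (simp add: u1 q0 algebra_simps)
  then obtain c' where c': "c = 4 * c'" by blast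
  have "b = 4 * (p2 + m1 + k0 * q2 - c)" using f2 by (simp add: u1 q0 q1(2) algebra_simps)
  then obtain b' where b': "b = 4 * b'" by blast
  define a' where "a' = 4 * b' - 16 * c'"
  have a': "a = 4 * a'" by (simp add: a b' c' a'_def)
  define X where "X = 16 * a'\<^sup>2 * b'\<^sup>2 - 16 * b' ^ 3 - 64 * a' ^ 3 * c' - 27 * c'\<^sup>2 + 72 * a' * b' * c'"
  have D: "D = 16 * X"
    unfolding D_def X_def a' b' c' by (simp add: power_mult_distrib algebra_simps)
  \<comment> \<open>If \<open>c\<close> were 8 or 16 up to sign, the right side would be a multiple
    of 512 and \<delta> even.\<close>
  have disc': "256 * \<delta> = c\<^sup>2 * (16 * X)" using disc \<open>h = -1\<close> D u1 by simp
  have "c = 4 \<or> c = -4"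
  proof -
    have "c = 4 \<or> c = -4 \<or> c\<^sup>2 = 64 \<or> c\<^sup>2 = 256" using c_cases c' by auto
    moreover have "c\<^sup>2 \<noteq> 64" "c\<^sup>2 \<noteq> 256" using disc' \<delta>(2) by auto
    ultimately show ?thesis by auto
  qed
  thus ?thesis using u1 a b' by auto
qed

section \<open>Rational roots of the completed square\<close>

text \<open>The function \<open>4 P + Q^2\<close> for \<open>P\<close> monic of degree 5, with the
  integer coefficients of \<open>P\<close> and \<open>Q\<close> kept as parameters: the congruences
  need this shape, not just the coefficients of the sum.\<close>

definition square_completion :: "int \<Rightarrow> int \<Rightarrow> int \<Rightarrow> int \<Rightarrow> int \<Rightarrow> int \<Rightarrow> int \<Rightarrow> int \<Rightarrow> rat \<Rightarrow> rat" where
  "square_completion p0 p1 p2 p3 p4 q0 q1 q2 x =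
     4 * (of_int p0 + of_int p1 * x + of_int p2 * x ^ 2 + of_int p3 * x ^ 3 + of_int p4 * x ^ 4 + x ^ 5)
     + (of_int q0 + of_int q1 * x + of_int q2 * x ^ 2) ^ 2"

lemma weq_F_eq_square_completion:
  assumes "integral_weq (P, Q)" "degree Q \<le> 2" "degree P = 5" "lead_coeff P = 1"
  obtains p0 p1 p2 p3 p4 q0 q1 q2 where
    "\<And>x. poly (weq_F (P, Q)) x = square_completion p0 p1 p2 p3 p4 q0 q1 q2 x"
proof -
  have "\<forall>i. \<exists>p. coeff P i = of_int p" "\<forall>i. \<exists>q. coeff Q i = of_int q"
    using assms(1) unfolding integral_weq_def Ints_def by auto
  then obtain p q where p: "\<And>i. coeff P i = of_int (p i)" and q: "\<And>i. coeff Q i = of_int (q i)" by metis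
  have "p 5 = 1" using assms(3,4) p[of 5] by simp
  hence "poly P x = of_int (p 0) + of_int (p 1) * x + of_int (p 2) * x ^ 2 + of_int (p 3) * x ^ 3
      + of_int (p 4) * x ^ 4 + x ^ 5" for x
    using poly_eq_sum_coeff[of P 5 x] assms(3) p by (simp add: eval_nat_numeral)
  moreover have "poly Q x = of_int (q 0) + of_int (q 1) * x + of_int (q 2) * x ^ 2" for x
    using poly_eq_sum_coeff[of Q 2 x] assms(2) q by (simp add: eval_nat_numeral)
  ultimately show ?thesis
    by (intro that[of "p 0" "p 1" "p 2" "p 3" "p 4" "q 0" "q 1" "q 2"])
      (simp add: weq_F_def square_completion_def)
qed

text \<open>Taylor expansion of \<open>P\<close> and \<open>Q\<close> at \<open>r\<close>;
  integrality and the leading coefficient of \<open>P\<close> survive.\<close>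

lemma square_completion_shift:
  obtains p0' p1' p2' p3' p4' q0' q1' q2' where
    "\<And>x. square_completion p0 p1 p2 p3 p4 q0 q1 q2 x
        = square_completion p0' p1' p2' p3' p4' q0' q1' q2' (x - of_int r)"
proof (rule that)
  fix x
  show "square_completion p0 p1 p2 p3 p4 q0 q1 q2 x = square_completion
      (p0 + p1 * r + p2 * r ^ 2 + p3 * r ^ 3 + p4 * r ^ 4 + r ^ 5)
      (p1 + 2 * p2 * r + 3 * p3 * r ^ 2 + 4 * p4 * r ^ 3 + 5 * r ^ 4)
      (p2 + 3 * p3 * r + 6 * p4 * r ^ 2 + 10 * r ^ 3)
      (p3 + 4 * p4 * r + 10 * r ^ 2) (p4 + 5 * r)
      (q0 + q1 * r + q2 * r ^ 2) (q1 + 2 * q2 * r) q2 (x - of_int r)"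
  proof -
    define y where "y = x - of_int r"
    have x: "x = y + of_int r" by (simp add: y_def)
    show ?thesis unfolding y_def[symmetric] unfolding x square_completion_def of_int_add of_int_mult of_int_power of_int_numeral
      by Groebner_Basis.algebra
  qed
qed

text \<open>By the rational root theorem the denominator divides the leading coefficient 4. The
  value 2 is ruled out by parity, using that \<open>Q\<close> enters as a square.\<close>

lemma square_completion_root:
  assumes "square_completion p0 p1 p2 p3 p4 q0 q1 q2 x = 0"
  shows "(\<exists>r. x = of_int r) \<or> (\<exists>u. odd u \<and> x = of_int u / 4)"
proof -
  obtain m n where mn: "quotient_of x = (m, n)" by (cases "quotient_of x")
  have x: "x = of_int m / of_int n" and n: "n > 0" and cop: "coprime m n"
    using mn quotient_of_div quotient_of_denom_pos quotient_of_coprime by blast+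
  define R where "R = p0 * n ^ 4 + p1 * m * n ^ 3 + p2 * m ^ 2 * n ^ 2 + p3 * m ^ 3 * n + p4 * m ^ 4"
  define Z where "Z = q0 * n ^ 2 + q1 * m * n + q2 * m ^ 2"
  have "rat_of_int (4 * m ^ 5 + n * (4 * R + Z\<^sup>2)) = of_int n ^ 5 * square_completion p0 p1 p2 p3 p4 q0 q1 q2 x"
  proof -
    have m: "of_int m = x * of_int n" using n by (simp add: x)
    show ?thesis
      unfolding R_def Z_def square_completion_def of_int_add of_int_mult of_int_power of_int_numeral m
      by Groebner_Basis.algebra
  qed
  hence eq: "4 * m ^ 5 + n * (4 * R + Z\<^sup>2) = 0" using assms by (metis mult_zero_right of_int_eq_0_iff)
  have "4 * m ^ 5 = (4 * m ^ 5 + n * (4 * R + Z\<^sup>2)) - n * (4 * R + Z\<^sup>2)" by simp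
  hence "n dvd 4 * m ^ 5" unfolding eq by simp
  moreover have "coprime n (m ^ 5)" using cop by (simp add: coprime_commute)
  ultimately have "n dvd 4" by (simp add: coprime_dvd_mult_left_iff)
  hence "n dvd 16" using dvd_trans[of n 4 16] by simp
  moreover have "n \<le> 4" using \<open>n dvd 4\<close> by (rule zdvd_imp_le) simp
  ultimately have "n = 1 \<or> n = 2 \<or> n = 4" using n dvd_16_cases[of n] by auto
  moreover have "n \<noteq> 2"
  proof
    assume "n = 2"
    hence eq': "Z\<^sup>2 + 2 * m ^ 5 + 4 * R = 0" using eq by simp
    hence "even (Z\<^sup>2 + 2 * m ^ 5 + 4 * R)" by simp
    hence "even Z" by simp
    then obtain z where "Z = 2 * z" by blast
    hence "m ^ 5 = 2 * (- z\<^sup>2 - R)" using eq' by simp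
    hence "even (m ^ 5)" by simp
    hence "even m" by simp
    thus False using cop \<open>n = 2\<close> by simp
  qed
  moreover have "odd m" if "n = 4"
  proof
    assume "even m"
    hence "2 dvd gcd m n" using that by simp
    thus False using cop by simp
  qed
  ultimately show ?thesis using x by auto
qed

text \<open>Scaling by 256 turns the leading term \<open>4 (u / 4)^5\<close> into
  \<open>u^5\<close>, so the equation for \<open>u\<close> is monic and integral.\<close>

lemma square_completion_quarter:
  assumes "square_completion p0 p1 p2 p3 p4 q0 q1 q2 (of_int u / 4) = 0"
  shows "u ^ 5 + (4 * p4 + q2\<^sup>2) * u ^ 4 + 4 * (4 * p3 + 2 * q1 * q2) * u ^ 3
    + 16 * (4 * p2 + q1\<^sup>2 + 2 * q0 * q2) * u ^ 2 + 64 * (4 * p1 + 2 * q0 * q1) * u + 256 * (4 * p0 + q0\<^sup>2) = 0"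
    (is "?G = 0")
proof -
  define y where "y = rat_of_int u / 4"
  have u: "of_int u = 4 * y" by (simp add: y_def)
  have "of_int ?G = 256 * square_completion p0 p1 p2 p3 p4 q0 q1 q2 y"
    unfolding square_completion_def of_int_add of_int_mult of_int_power of_int_numeral u
    by Groebner_Basis.algebra
  hence "rat_of_int ?G = 0" using assms by (simp add: y_def)
  thus ?thesis by (simp only: of_int_eq_0_iff)
qed

text \<open>Modulo 2 the quotient \<open>(F(u/4) - F(w/4)) / (u - w)\<close> (after clearing denominators) is a sum
  of five odd terms, so it cannot vanish.\<close>

lemma square_completion_quarter_roots_unique:
  assumes "square_completion p0 p1 p2 p3 p4 q0 q1 q2 (of_int u / 4) = 0"
    and "square_completion p0 p1 p2 p3 p4 q0 q1 q2 (of_int w / 4) = 0"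
    and "odd u" "odd w"
  shows "u = w"
proof (rule ccontr)
  assume neq: "u \<noteq> w"
  define f0 f1 f2 f3 f4 where "f0 = 4 * p0 + q0\<^sup>2" and "f1 = 4 * p1 + 2 * q0 * q1"
    and "f2 = 4 * p2 + q1\<^sup>2 + 2 * q0 * q2" and "f3 = 4 * p3 + 2 * q1 * q2" and "f4 = 4 * p4 + q2\<^sup>2"
  note f_defs = this
  define X where "X = (u ^ 4 + u ^ 3 * w + u\<^sup>2 * w\<^sup>2 + u * w ^ 3 + w ^ 4)
    + f4 * (u ^ 3 + u\<^sup>2 * w + u * w\<^sup>2 + w ^ 3) + 4 * f3 * (u\<^sup>2 + u * w + w\<^sup>2) + 16 * f2 * (u + w) + 64 * f1"
  have "(u - w) * X = 0"
    unfolding X_def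
    using square_completion_quarter[OF assms(1)] square_completion_quarter[OF assms(2)]
    unfolding f_defs[symmetric] by Groebner_Basis.algebra
  hence "X = 0" using neq by simp
  moreover have "odd X" unfolding X_def using assms(3,4) by simp
  ultimately show False by simp
qed

text \<open>Synthetic division by \<open>z (z - s)\<close> from the top coefficient down. The
  divisor is monic, so \<open>a\<close>, \<open>b\<close>, \<open>c\<close> are integers; the
  vanishing remainders give the first two equations.\<close>

lemma square_completion_integer_factor:
  assumes "square_completion p0 p1 p2 p3 p4 q0 q1 q2 0 = 0"
    and "square_completion p0 p1 p2 p3 p4 q0 q1 q2 (of_int s) = 0" and "s \<noteq> 0"
  obtains a b c :: int where "0 = 4 * p0 + q0\<^sup>2" "- s * c = 4 * p1 + 2 * q0 * q1"
    "c - s * b = 4 * p2 + q1\<^sup>2 + 2 * q0 * q2" "b - s * a = 4 * p3 + 2 * q1 * q2" "a - 4 * s = 4 * p4 + q2\<^sup>2"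
    "\<And>z. square_completion p0 p1 p2 p3 p4 q0 q1 q2 z
       = z * (z - of_int s) * (4 * z ^ 3 + of_int a * z\<^sup>2 + of_int b * z + of_int c)"
proof -
  define a where "a = 4 * p4 + q2\<^sup>2 + 4 * s"
  define b where "b = 4 * p3 + 2 * q1 * q2 + s * a"
  define c where "c = 4 * p2 + q1\<^sup>2 + 2 * q0 * q2 + s * b"
  have "rat_of_int (4 * p0 + q0\<^sup>2) = 0" using assms(1) by (simp add: square_completion_def)
  hence f0: "0 = 4 * p0 + q0\<^sup>2" by (simp only: of_int_eq_0_iff)
  have "rat_of_int (s * (4 * p1 + 2 * q0 * q1 + s * c) + (4 * p0 + q0\<^sup>2)) = square_completion p0 p1 p2 p3 p4 q0 q1 q2 (of_int s)"
    unfolding c_def b_def a_def square_completion_def of_int_add of_int_mult of_int_power of_int_numeral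
    by Groebner_Basis.algebra
  hence "s * (4 * p1 + 2 * q0 * q1 + s * c) + (4 * p0 + q0\<^sup>2) = 0"
    using assms(2) by (simp only: of_int_eq_0_iff)
  hence f1: "- s * c = 4 * p1 + 2 * q0 * q1" using assms(3) f0 by simp
  have f2: "c - s * b = 4 * p2 + q1\<^sup>2 + 2 * q0 * q2" and f3: "b - s * a = 4 * p3 + 2 * q1 * q2"
    and f4: "a - 4 * s = 4 * p4 + q2\<^sup>2"
    by (simp_all add: a_def b_def c_def)
  note f = f0 f1 f2 f3 f4
  \<comment> \<open>The coefficient relations cast to the rationals, as input for the Groebner basis
    step.\<close>
  note f[THEN arg_cong[of _ _ rat_of_int], unfolded of_int_add of_int_diff of_int_minus of_int_mult of_int_power of_int_numeral of_int_0]
  hence "square_completion p0 p1 p2 p3 p4 q0 q1 q2 z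
       = z * (z - of_int s) * (4 * z ^ 3 + of_int a * z\<^sup>2 + of_int b * z + of_int c)" for z
    unfolding square_completion_def by Groebner_Basis.algebra
  with f show thesis by (rule that)
qed

text \<open>The divisor \<open>4 z - u\<close> is not monic, so integrality of the quotient is an
  instance of Gauss's lemma. It is carried out by hand: the root equation is read modulo 4 three
  times, each time cancelling a power of the odd \<open>u\<close>.\<close>

lemma square_completion_quarter_factor:
  assumes "square_completion p0 p1 p2 p3 p4 q0 q1 q2 0 = 0"
    and "square_completion p0 p1 p2 p3 p4 q0 q1 q2 (of_int u / 4) = 0" and "odd u"
  obtains a b c :: int where "0 = 4 * p0 + q0\<^sup>2" "- u * c = 4 * p1 + 2 * q0 * q1"
    "4 * c - u * b = 4 * p2 + q1\<^sup>2 + 2 * q0 * q2" "4 * b - u * a = 4 * p3 + 2 * q1 * q2"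
    "4 * a - u = 4 * p4 + q2\<^sup>2"
    "\<And>z. square_completion p0 p1 p2 p3 p4 q0 q1 q2 z
       = z * (4 * z - of_int u) * (z ^ 3 + of_int a * z\<^sup>2 + of_int b * z + of_int c)"
proof -
  define f1 f2 f3 f4 where "f1 = 4 * p1 + 2 * q0 * q1"
    and "f2 = 4 * p2 + q1\<^sup>2 + 2 * q0 * q2" and "f3 = 4 * p3 + 2 * q1 * q2" and "f4 = 4 * p4 + q2\<^sup>2"
  note f_defs = this
  have "rat_of_int (4 * p0 + q0\<^sup>2) = 0" using assms(1) by (simp add: square_completion_def)
  hence f0: "0 = 4 * p0 + q0\<^sup>2" by (simp only: of_int_eq_0_iff)
  have u0: "u \<noteq> 0" using assms(3) by auto
  have cop: "coprime 4 (u ^ k)" for k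
  proof -
    have "coprime 2 u" using assms(3) by simp
    hence "coprime (2 ^ 2) (u ^ k)"
      by (simp only: coprime_power_left_iff coprime_power_right_iff simp_thms)
    thus ?thesis by simp
  qed
  have "u * (u ^ 3 * (u + f4) + 4 * (f3 * u\<^sup>2 + 4 * f2 * u + 16 * f1)) = 0"
    using square_completion_quarter[OF assms(2)] unfolding f_defs[symmetric] f0[symmetric]
    by (simp add: algebra_simps eval_nat_numeral)
  hence 1: "u ^ 3 * (u + f4) = 4 * (- (f3 * u\<^sup>2 + 4 * f2 * u + 16 * f1))" using u0 by simp
  hence "4 dvd u ^ 3 * (u + f4)" by (rule dvdI)
  hence "4 dvd u + f4" using cop by (simp only: coprime_dvd_mult_right_iff)
  then obtain a where a: "u + f4 = 4 * a" by blast
  have "4 * (u\<^sup>2 * (u * a + f3) + 4 * (f2 * u + 4 * f1)) = 0"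
    using 1 unfolding a by (simp add: algebra_simps eval_nat_numeral)
  hence 2: "u\<^sup>2 * (u * a + f3) = 4 * (- (f2 * u + 4 * f1))" by simp
  hence "4 dvd u\<^sup>2 * (u * a + f3)" by (rule dvdI)
  hence "4 dvd u * a + f3" using cop by (simp only: coprime_dvd_mult_right_iff)
  then obtain b where b: "u * a + f3 = 4 * b" by blast
  have "4 * (u ^ 1 * (u * b + f2) + 4 * f1) = 0"
    using 2 unfolding b by (simp add: algebra_simps eval_nat_numeral)
  hence 3: "u ^ 1 * (u * b + f2) = 4 * (- f1)" by simp
  hence "4 dvd u ^ 1 * (u * b + f2)" by (rule dvdI)
  hence "4 dvd u * b + f2" using cop by (simp only: coprime_dvd_mult_right_iff)
  then obtain c where c: "u * b + f2 = 4 * c" by blast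
  have f1: "- u * c = f1" using 3 unfolding c by (simp add: mult.commute)
  have f2: "4 * c - u * b = f2" and f3: "4 * b - u * a = f3" and f4: "4 * a - u = f4"
    using a b c by simp_all
  note f = f0 f1[unfolded f_defs] f2[unfolded f_defs] f3[unfolded f_defs] f4[unfolded f_defs]
  note f[THEN arg_cong[of _ _ rat_of_int], unfolded of_int_add of_int_diff of_int_minus of_int_mult of_int_power of_int_numeral of_int_0]
  hence "square_completion p0 p1 p2 p3 p4 q0 q1 q2 z
       = z * (4 * z - of_int u) * (z ^ 3 + of_int a * z\<^sup>2 + of_int b * z + of_int c)" for z
    unfolding square_completion_def by Groebner_Basis.algebra
  with f show thesis by (rule that)
qed

section \<open>The two families\<close>

lemma poly_weq_F_E_fam:
  "poly (weq_F (E_fam t)) x = x * (4 * x + 1) * (x ^ 3 + 16 * of_int t * x\<^sup>2 + (16 + 4 * of_int t) * x + 4)"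
  unfolding weq_F_def E_fam_def by simp Groebner_Basis.algebra

lemma poly_weq_F_F_fam:
  "poly (weq_F (F_fam t)) x = x * (x - 1) * (4 * x ^ 3 + (4 * of_int t + 1) * x\<^sup>2 - (4 * of_int t + 5) * x + 4)"
  unfolding weq_F_def F_fam_def by simp Groebner_Basis.algebra

text \<open>With \<open>u = -1\<close> and \<open>c = 4\<close> the value \<open>h\<close> is -1,
  whence the factor 16.\<close>

lemma weq_disc_E_fam:
  "256 * weq_disc (E_fam t) = 16 * ((16 * of_int t)\<^sup>2 * (16 + 4 * of_int t)\<^sup>2 - 4 * (16 + 4 * of_int t) ^ 3
     - 4 * (16 * of_int t) ^ 3 * 4 - 27 * 4\<^sup>2 + 18 * (16 * of_int t) * (16 + 4 * of_int t) * 4)"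
  using weq_disc_quarter_root[of "E_fam t" 0 "-1" "16 * of_int t" "16 + 4 * of_int t" 4]
  unfolding poly_weq_F_E_fam by simp

lemma weq_disc_F_fam:
  "256 * weq_disc (F_fam t) = 256 * ((4 * of_int t + 1)\<^sup>2 * (4 * of_int t + 5)\<^sup>2 + 16 * (4 * of_int t + 5) ^ 3
     - 16 * (4 * of_int t + 1) ^ 3 - 6912 - 288 * (4 * of_int t + 1) * (4 * of_int t + 5))"
proof -
  have "256 * weq_disc (F_fam t) = (1 * 4 * (4 * 1 ^ 3 + (4 * of_int t + 1) * 1\<^sup>2 + - (4 * of_int t + 5) * 1 + 4))\<^sup>2
      * ((4 * of_int t + 1)\<^sup>2 * (- (4 * of_int t + 5))\<^sup>2 - 16 * (- (4 * of_int t + 5)) ^ 3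
      - 4 * (4 * of_int t + 1) ^ 3 * 4 - 432 * 4\<^sup>2 + 72 * (4 * of_int t + 1) * - (4 * of_int t + 5) * 4)"
    by (rule weq_disc_integer_roots[of "F_fam t" 0]) (simp add: poly_weq_F_F_fam algebra_simps)
  thus ?thesis unfolding power_one mult_1_left mult_1_right by Groebner_Basis.algebra
qed

lemma integral_weq_E_fam: "integral_weq (E_fam t)"
  unfolding integral_weq_def E_fam_def by (auto simp: coeff_pCons split: nat.split)

lemma integral_weq_F_fam: "integral_weq (F_fam t)"
  unfolding integral_weq_def F_fam_def by (auto simp: coeff_pCons split: nat.split)

lemma degree_E_fam: "degree (fst (E_fam t)) \<le> 6" "degree (snd (E_fam t)) \<le> 3"
  unfolding E_fam_def by (simp_all add: degree_pCons_eq_if)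

lemma degree_F_fam: "degree (fst (F_fam t)) \<le> 6" "degree (snd (F_fam t)) \<le> 3"
  unfolding F_fam_def by (simp_all add: degree_pCons_eq_if)

text \<open>Combines a Moebius map for the shifted function \<open>G\<close> with the translation by
  \<open>r\<close>: the matrix gets \<open>r\<close> times its second row added to the first, which
  keeps its determinant.\<close>

lemma iso_globally_minimal:
  assumes "degree (fst E) \<le> 6" "degree (snd E) \<le> 3" "globally_minimal E"
    and "degree (fst E') \<le> 6" "degree (snd E') \<le> 3" "integral_weq E'"
    and "256 * weq_disc E' = 256 * weq_disc E"
    and "\<And>x. poly (weq_F E) x = G (x - r)" and "a * d - b * c \<noteq> 0"
    and "\<And>x. c * x + d \<noteq> 0 \<Longrightarrow> poly (weq_F E') x = (c * x + d) ^ 6 * G ((a * x + b) / (c * x + d))"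
  shows "weq_iso E E' \<and> globally_minimal E'"
proof -
  have "weq_iso E E'"
  proof (rule weq_isoI[OF assms(1,2,5)])
    show "(a + r * c) * d - (b + r * d) * c \<noteq> 0" using assms(9) by (simp add: algebra_simps)
    fix x assume x: "c * x + d \<noteq> 0"
    have "((a + r * c) * x + (b + r * d)) / (c * x + d) - r = (a * x + b) / (c * x + d)"
      using x by (simp add: field_simps)
    thus "poly (weq_F E') x = (c * x + d) ^ 6 * poly (weq_F E) (((a + r * c) * x + (b + r * d)) / (c * x + d))"
      using assms(8,10) x by simp
  qed
  thus ?thesis using globally_minimal_transfer assms by simp
qed

text \<open>Pushes casts down to the variables, leaving ring identities over the rationals.\<close>

lemmas arith_unfold = of_int_add of_int_diff of_int_minus of_int_mult of_int_power of_int_numeral of_int_1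
  power_one mult_1_left mult_1_right mult_zero_left add_0_left add_0_right

lemma integer_roots_iso_families:
  assumes deg: "degree (fst E) \<le> 6" "degree (snd E) \<le> 3" and min: "globally_minimal E"
    and F: "\<And>x. poly (weq_F E) x = square_completion p0 p1 p2 p3 p4 q0 q1 q2 (x - of_int r)"
    and roots: "square_completion p0 p1 p2 p3 p4 q0 q1 q2 0 = 0"
      "square_completion p0 p1 p2 p3 p4 q0 q1 q2 (of_int s) = 0" "s > 0"
    and \<delta>: "weq_disc E = of_int \<delta>" "squarefree \<delta>" "odd \<delta>"
  shows "\<exists>t. (weq_iso E (E_fam t) \<and> globally_minimal (E_fam t)) \<or> (weq_iso E (F_fam t) \<and> globally_minimal (F_fam t))"
proof -
  have "s \<noteq> 0" using roots(3) by simp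
  obtain a b c :: int where f: "0 = 4 * p0 + q0\<^sup>2" "- s * c = 4 * p1 + 2 * q0 * q1"
    "c - s * b = 4 * p2 + q1\<^sup>2 + 2 * q0 * q2" "b - s * a = 4 * p3 + 2 * q1 * q2" "a - 4 * s = 4 * p4 + q2\<^sup>2"
    and G: "\<And>z. square_completion p0 p1 p2 p3 p4 q0 q1 q2 z
       = z * (z - of_int s) * (4 * z ^ 3 + of_int a * z\<^sup>2 + of_int b * z + of_int c)"
    by (rule square_completion_integer_factor[OF roots(1,2) \<open>s \<noteq> 0\<close>], rule that)
  have disc: "256 * weq_disc E = of_int ((s * c * (4 * s ^ 3 + a * s\<^sup>2 + b * s + c))\<^sup>2
      * (a\<^sup>2 * b\<^sup>2 - 16 * b ^ 3 - 4 * a ^ 3 * c - 432 * c\<^sup>2 + 72 * a * b * c))"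
    using weq_disc_integer_roots[of E "of_int r" "of_int s" "of_int a" "of_int b" "of_int c"]
    unfolding F G by simp
  have "256 * \<delta> = (s * c * (4 * s ^ 3 + a * s\<^sup>2 + b * s + c))\<^sup>2
      * (a\<^sup>2 * b\<^sup>2 - 16 * b ^ 3 - 4 * a ^ 3 * c - 432 * c\<^sup>2 + 72 * a * b * c)"
  proof -
    have "rat_of_int (256 * \<delta>) = of_int ((s * c * (4 * s ^ 3 + a * s\<^sup>2 + b * s + c))\<^sup>2
      * (a\<^sup>2 * b\<^sup>2 - 16 * b ^ 3 - 4 * a ^ 3 * c - 432 * c\<^sup>2 + 72 * a * b * c))"
      using disc \<delta>(1) by (simp only: of_int_mult of_int_numeral)
    thus ?thesis by (simp only: of_int_eq_iff)
  qed
  from integer_roots_cases[OF roots(3) f this \<delta>(2,3)] consider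
      a' where "s = 4" "c = 1" "a = 4 * a'" "b = - 64 - 16 * a'"
    | t where "s = 1" "a = 4 * t + 1" "c = 4" "b = - 4 - a"
    | t where "s = 1" "a = 4 * t + 1" "c = -4" "b = - 4 - a"
    | t where "s = 1" "a = 4 * t + 1" "c = -4" "b = 4 - a" by blast
  thus ?thesis
  proof cases
    case (1 a')
    \<comment> \<open>The map \<open>4 + 1 / x\<close> sends -1/4, 0 and infinity to 0, infinity and
      4. The parameter is read off the transformed cubic, whose \<open>x^2\<close> coefficient is
      \<open>16 a' + 128\<close>.\<close>
    have "weq_iso E (E_fam (a' + 8)) \<and> globally_minimal (E_fam (a' + 8))"
    proof (rule iso_globally_minimal[OF deg min degree_E_fam integral_weq_E_fam _ F])
      show "256 * weq_disc (E_fam (a' + 8)) = 256 * weq_disc E"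
        unfolding weq_disc_E_fam disc 1 arith_unfold
        by Groebner_Basis.algebra
      show "4 * 0 - 1 * 1 \<noteq> (0::rat)" by simp
      fix x :: rat assume x: "1 * x + 0 \<noteq> 0"
      define w where "w = 1 / x"
      have w: "x * w = 1" "(4 * x + 1) / (1 * x + 0) = 4 + w" using x by (simp_all add: w_def field_simps)
      show "poly (weq_F (E_fam (a' + 8))) x = (1 * x + 0) ^ 6 * square_completion p0 p1 p2 p3 p4 q0 q1 q2 ((4 * x + 1) / (1 * x + 0))"
        unfolding poly_weq_F_E_fam w(2) G unfolding 1 arith_unfold
        using w(1) by Groebner_Basis.algebra
    qed
    thus ?thesis by blast
  next
    case (2 t)
    have "weq_iso E (F_fam t) \<and> globally_minimal (F_fam t)"
    proof (rule iso_globally_minimal[OF deg min degree_F_fam integral_weq_F_fam _ F])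
      show "256 * weq_disc (F_fam t) = 256 * weq_disc E"
        unfolding weq_disc_F_fam disc 2 arith_unfold
        by Groebner_Basis.algebra
      show "1 * 1 - 0 * 0 \<noteq> (0::rat)" by simp
      fix x :: rat
      have w: "(1 * x + 0) / (0 * x + 1) = x" by simp
      show "poly (weq_F (F_fam t)) x = (0 * x + 1) ^ 6 * square_completion p0 p1 p2 p3 p4 q0 q1 q2 ((1 * x + 0) / (0 * x + 1))"
        unfolding poly_weq_F_F_fam w G unfolding 2 arith_unfold
        by Groebner_Basis.algebra
    qed
    thus ?thesis by blast
  next
    case (3 t)
    \<comment> \<open>The map \<open>1 - 1 / x\<close> permutes 0, 1 and infinity
      cyclically.\<close>
    have "weq_iso E (F_fam (t + 2)) \<and> globally_minimal (F_fam (t + 2))"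
    proof (rule iso_globally_minimal[OF deg min degree_F_fam integral_weq_F_fam _ F])
      show "256 * weq_disc (F_fam (t + 2)) = 256 * weq_disc E"
        unfolding weq_disc_F_fam disc 3 arith_unfold
        by Groebner_Basis.algebra
      show "1 * 0 - (-1) * 1 \<noteq> (0::rat)" by simp
      fix x :: rat assume x: "1 * x + 0 \<noteq> 0"
      define w where "w = 1 / x"
      have w: "x * w = 1" "(1 * x + -1) / (1 * x + 0) = 1 - w" using x by (simp_all add: w_def field_simps)
      show "poly (weq_F (F_fam (t + 2))) x = (1 * x + 0) ^ 6 * square_completion p0 p1 p2 p3 p4 q0 q1 q2 ((1 * x + -1) / (1 * x + 0))"
        unfolding poly_weq_F_F_fam w(2) G unfolding 3 arith_unfold
        using w(1) by Groebner_Basis.algebra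
    qed
    thus ?thesis by blast
  next
    case (4 t)
    \<comment> \<open>The map \<open>x / (x - 1)\<close> fixes 0 and swaps 1 and infinity.\<close>
    have "weq_iso E (F_fam (t + 1)) \<and> globally_minimal (F_fam (t + 1))"
    proof (rule iso_globally_minimal[OF deg min degree_F_fam integral_weq_F_fam _ F])
      show "256 * weq_disc (F_fam (t + 1)) = 256 * weq_disc E"
        unfolding weq_disc_F_fam disc 4 arith_unfold
        by Groebner_Basis.algebra
      show "1 * (-1) - 0 * 1 \<noteq> (0::rat)" by simp
      fix x :: rat assume x: "1 * x + -1 \<noteq> 0"
      define w where "w = 1 / (x - 1)"
      have w: "(x - 1) * w = 1" "(1 * x + 0) / (1 * x + -1) = x * w" using x by (simp_all add: w_def field_simps)
      show "poly (weq_F (F_fam (t + 1))) x = (1 * x + -1) ^ 6 * square_completion p0 p1 p2 p3 p4 q0 q1 q2 ((1 * x + 0) / (1 * x + -1))"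
        unfolding poly_weq_F_F_fam w(2) G unfolding 4 arith_unfold
        using w(1) by Groebner_Basis.algebra
    qed
    thus ?thesis by blast
  qed
qed

lemma quarter_root_iso_families:
  assumes deg: "degree (fst E) \<le> 6" "degree (snd E) \<le> 3" and min: "globally_minimal E"
    and F: "\<And>x. poly (weq_F E) x = square_completion p0 p1 p2 p3 p4 q0 q1 q2 (x - of_int r)"
    and roots: "square_completion p0 p1 p2 p3 p4 q0 q1 q2 0 = 0"
      "square_completion p0 p1 p2 p3 p4 q0 q1 q2 (of_int u / 4) = 0" "odd u"
    and \<delta>: "weq_disc E = of_int \<delta>" "squarefree \<delta>" "odd \<delta>"
  shows "\<exists>t. weq_iso E (E_fam t) \<and> globally_minimal (E_fam t)"
proof -
  obtain a b c :: int where f: "0 = 4 * p0 + q0\<^sup>2" "- u * c = 4 * p1 + 2 * q0 * q1"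
    "4 * c - u * b = 4 * p2 + q1\<^sup>2 + 2 * q0 * q2" "4 * b - u * a = 4 * p3 + 2 * q1 * q2" "4 * a - u = 4 * p4 + q2\<^sup>2"
    and G: "\<And>z. square_completion p0 p1 p2 p3 p4 q0 q1 q2 z
       = z * (4 * z - of_int u) * (z ^ 3 + of_int a * z\<^sup>2 + of_int b * z + of_int c)"
    by (rule square_completion_quarter_factor[OF roots], rule that)
  have disc: "256 * weq_disc E = of_int ((u * c * (u ^ 3 + 4 * a * u\<^sup>2 + 16 * b * u + 64 * c))\<^sup>2
      * (a\<^sup>2 * b\<^sup>2 - 4 * b ^ 3 - 4 * a ^ 3 * c - 27 * c\<^sup>2 + 18 * a * b * c))"
    using weq_disc_quarter_root[of E "of_int r" "of_int u" "of_int a" "of_int b" "of_int c"]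
    unfolding F G by simp
  have "256 * \<delta> = (u * c * (u ^ 3 + 4 * a * u\<^sup>2 + 16 * b * u + 64 * c))\<^sup>2
      * (a\<^sup>2 * b\<^sup>2 - 4 * b ^ 3 - 4 * a ^ 3 * c - 27 * c\<^sup>2 + 18 * a * b * c)"
  proof -
    have "rat_of_int (256 * \<delta>) = of_int ((u * c * (u ^ 3 + 4 * a * u\<^sup>2 + 16 * b * u + 64 * c))\<^sup>2
      * (a\<^sup>2 * b\<^sup>2 - 4 * b ^ 3 - 4 * a ^ 3 * c - 27 * c\<^sup>2 + 18 * a * b * c))"
      using disc \<delta>(1) by (simp only: of_int_mult of_int_numeral)
    thus ?thesis by (simp only: of_int_eq_iff)
  qed
  from quarter_root_cases[OF roots(3) f this \<delta>(2,3)] consider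
      b' where "u = -1" "b = 4 * b'" "c = 4" "a = 16 * b' - 64"
    | b' where "u = -1" "b = 4 * b'" "c = -4" "a = 16 * b' + 64" by blast
  thus ?thesis
  proof cases
    case (1 b')
    have "weq_iso E (E_fam (b' - 4)) \<and> globally_minimal (E_fam (b' - 4))"
    proof (rule iso_globally_minimal[OF deg min degree_E_fam integral_weq_E_fam _ F])
      show "256 * weq_disc (E_fam (b' - 4)) = 256 * weq_disc E"
        unfolding weq_disc_E_fam disc 1 arith_unfold
        by Groebner_Basis.algebra
      show "1 * 1 - 0 * 0 \<noteq> (0::rat)" by simp
      fix x :: rat
      have w: "(1 * x + 0) / (0 * x + 1) = x" by simp
      show "poly (weq_F (E_fam (b' - 4))) x = (0 * x + 1) ^ 6 * square_completion p0 p1 p2 p3 p4 q0 q1 q2 ((1 * x + 0) / (0 * x + 1))"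
        unfolding poly_weq_F_E_fam w G unfolding 1 arith_unfold
        by Groebner_Basis.algebra
    qed
    thus ?thesis by blast
  next
    case (2 b')
    \<comment> \<open>The map \<open>- x / (4 x + 1)\<close> fixes 0 and swaps -1/4 and infinity;
      this changes the sign of the constant term of the cubic.\<close>
    have "weq_iso E (E_fam (b' + 8)) \<and> globally_minimal (E_fam (b' + 8))"
    proof (rule iso_globally_minimal[OF deg min degree_E_fam integral_weq_E_fam _ F])
      show "256 * weq_disc (E_fam (b' + 8)) = 256 * weq_disc E"
        unfolding weq_disc_E_fam disc 2 arith_unfold
        by Groebner_Basis.algebra
      show "(-1) * 1 - 0 * 4 \<noteq> (0::rat)" by simp
      fix x :: rat assume x: "4 * x + 1 \<noteq> 0"
      define w where "w = 1 / (4 * x + 1)"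
      have w: "(4 * x + 1) * w = 1" "(- 1 * x + 0) / (4 * x + 1) = - x * w" using x by (simp_all add: w_def field_simps)
      show "poly (weq_F (E_fam (b' + 8))) x = (4 * x + 1) ^ 6 * square_completion p0 p1 p2 p3 p4 q0 q1 q2 ((- 1 * x + 0) / (4 * x + 1))"
        unfolding poly_weq_F_E_fam w(2) G unfolding 2 arith_unfold
        using w(1) by Groebner_Basis.algebra
    qed
    thus ?thesis by blast
  qed
qed

theorem theorem7p1:
  fixes P Q :: "rat poly"
  assumes "is_genus2_weq (P, Q)"
    and "good_reduction_at 2 (P, Q)"
    and "num_rat_weierstrass_pts (P, Q) = 3"
    and "globally_minimal (P, Q)"
    and "integral_weq (P, Q)"
    and "degree Q \<le> 2"
    and "degree P = 5" and "lead_coeff P = 1"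
    and "weq_disc (P, Q) \<in> \<int>"
    and "squarefree \<lfloor>\<bar>weq_disc (P, Q)\<bar>\<rfloor>"
    and "odd \<lfloor>\<bar>weq_disc (P, Q)\<bar>\<rfloor>"
  shows "\<exists>t :: int. (weq_iso (P, Q) (E_fam t) \<and> globally_minimal (E_fam t))
                 \<or> (weq_iso (P, Q) (F_fam t) \<and> globally_minimal (F_fam t))"
proof -
  from assms(9) obtain \<delta> where \<delta>: "weq_disc (P, Q) = of_int \<delta>" by (elim Ints_cases)
  hence "\<lfloor>\<bar>weq_disc (P, Q)\<bar>\<rfloor> = \<bar>\<delta>\<bar>" by (metis floor_of_int of_int_abs)
  hence \<delta>': "squarefree \<delta>" "odd \<delta>" using assms(10,11) by (simp_all add: squarefree_def)
  have deg: "degree (fst (P, Q)) \<le> 6" "degree (snd (P, Q)) \<le> 3" using assms(6,7) by simp_all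
  obtain p0 p1 p2 p3 p4 q0 q1 q2 where
    F: "\<And>x. poly (weq_F (P, Q)) x = square_completion p0 p1 p2 p3 p4 q0 q1 q2 x"
    by (rule weq_F_eq_square_completion[OF assms(5-8)], rule that)
  let ?F = "square_completion p0 p1 p2 p3 p4 q0 q1 q2"
  \<comment> \<open>Infinity is thus one of the three rational Weierstrass points, leaving two
    rational roots.\<close>
  have "degree (weq_F (P, Q)) \<le> 5"
    unfolding weq_F_def using assms(6,7) degree_power_le[of Q 2]
    by (intro degree_add_le) (auto intro: order.trans)
  hence "card {x. ?F x = 0} = 2"
    using assms(3) by (simp add: num_rat_weierstrass_pts_def F)
  then obtain x y where "{x. ?F x = 0} = {x, y}" "x \<noteq> y" by (auto simp: card_2_iff)
  hence xy: "?F x = 0" "?F y = 0" "x \<noteq> y" by auto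
  \<comment> \<open>The smaller root is moved to 0, so that the other becomes a positive
    \<open>s\<close>.\<close>
  have two_integers: ?thesis if "?F (of_int r) = 0" "?F (of_int r') = 0" "r < r'" for r r'
  proof -
    obtain p0' p1' p2' p3' p4' q0' q1' q2' where
      shift: "\<And>x. ?F x = square_completion p0' p1' p2' p3' p4' q0' q1' q2' (x - of_int r)"
      by (rule square_completion_shift[of p0 p1 p2 p3 p4 q0 q1 q2 r], rule that)
    have F': "\<And>x. poly (weq_F (P, Q)) x = square_completion p0' p1' p2' p3' p4' q0' q1' q2' (x - of_int r)"
      using F shift by simp
    have roots: "square_completion p0' p1' p2' p3' p4' q0' q1' q2' 0 = 0"
      "square_completion p0' p1' p2' p3' p4' q0' q1' q2' (of_int (r' - r)) = 0"
      using that shift[of "of_int r"] shift[of "of_int r'"] by simp_all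
    show ?thesis
      by (rule integer_roots_iso_families[OF deg assms(4) F' roots _ \<delta> \<delta>']) (use that in simp)
  qed
  have integer_and_quarter: ?thesis if "?F (of_int r) = 0" "?F (of_int u / 4) = 0" "odd u" for r u
  proof -
    obtain p0' p1' p2' p3' p4' q0' q1' q2' where
      shift: "\<And>x. ?F x = square_completion p0' p1' p2' p3' p4' q0' q1' q2' (x - of_int r)"
      by (rule square_completion_shift[of p0 p1 p2 p3 p4 q0 q1 q2 r], rule that)
    \<comment> \<open>Moving the integral root to 0 keeps the other a quarter of an odd
      integer.\<close>
    have eq: "rat_of_int (u - 4 * r) / 4 = of_int u / 4 - of_int r" by (simp add: field_simps)
    have roots: "square_completion p0' p1' p2' p3' p4' q0' q1' q2' 0 = 0"
      "square_completion p0' p1' p2' p3' p4' q0' q1' q2' (of_int (u - 4 * r) / 4) = 0"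
      unfolding eq using that shift[of "of_int r"] shift[of "of_int u / 4"] by simp_all
    have F': "\<And>x. poly (weq_F (P, Q)) x = square_completion p0' p1' p2' p3' p4' q0' q1' q2' (x - of_int r)"
      using F shift by simp
    have "odd (u - 4 * r)" using that by simp
    from quarter_root_iso_families[OF deg assms(4) F' roots this \<delta> \<delta>'] show ?thesis by blast
  qed
  from square_completion_root[OF xy(1)] square_completion_root[OF xy(2)] show ?thesis
  proof (elim disjE exE conjE)
    fix r r' assume "x = of_int r" "y = of_int r'"
    thus ?thesis using xy two_integers[of r r'] two_integers[of r' r] by (cases r r' rule: linorder_cases) auto
  next
    fix r u assume "x = of_int r" "odd u" "y = of_int u / 4"
    thus ?thesis using xy integer_and_quarter[of r u] by metis
  next
    fix r u assume "odd u" "x = of_int u / 4" "y = of_int r"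
    thus ?thesis using xy integer_and_quarter[of r u] by metis
  next
    \<comment> \<open>Two quarter roots would coincide, against \<open>x \<noteq> y\<close>.\<close>
    fix u w assume "odd u" "x = of_int u / 4" "odd w" "y = of_int w / 4"
    thus ?thesis using xy square_completion_quarter_roots_unique by metis
  qed
qed

end
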